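(* Let $n\geq 2$. There exists a constant $C_n>0$ depending only on $n$ such that, for every smooth, bounded domain $\Omega\subset\mathbb R^n$ and every integer $k\geq 1$, $$|\Omega|^{\frac 1n}\,\sigma_k(\Omega)\leq C_n\, k^{\frac 1{n-1}}.$$
   Context: A domain is a connected open set; $|\Omega|$ denotes the $n$-dimensional Lebesgue measure of $\Omega$. The Steklov eigenvalues of a smooth, bounded domain $\Omega\subset\mathbb R^n$ are the numbers $\sigma$ for which the problem $$\sum_{i=1}^n\partial_{ii}^2u=0 \text{ in }\Omega,\qquad \partial_N u=\sigma u\text{ on }\partial\Omega$$ ($N$ the outer unit normal) has a nontrivial solution; they form a sequence, repeated according to multiplicity, indexed starting from $1$: $$0=\sigma_1(\Omega)<\sigma_2(\Omega)\leq\cdots\leq\sigma_k(\Omega)\leq\cdots\nearrow+\infty .$$ Equivalently, $$\sigma_k(\Omega)=\min_{\substack{V\subset H^1(\Omega)\\ \dim V=k}}\ \max_{0\neq\phi\in V}\frac{\int_\Omega|\nabla\phi|^2}{\int_{\partial\Omega}\phi^2},$$ where the quotient is understood as $+\infty$ when the trace of $\phi\ne0$ on $\partial\Omega$ vanishes. *)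

theory Defs
  imports "HOL-Analysis.Analysis"
begin

section \<open>Smooth functions and smooth bounded domains\<close>

definition partial_deriv :: "'n::finite \<Rightarrow> (real^'n \<Rightarrow> real) \<Rightarrow> real^'n \<Rightarrow> real" where
  "partial_deriv i f x = frechet_derivative f (at x) (axis i 1)"

definition gradient :: "(real^'n::finite \<Rightarrow> real) \<Rightarrow> real^'n \<Rightarrow> real^'n" where
  "gradient f x = (\<chi> i. partial_deriv i f x)"

text \<open>Only used for open sets \<open>S\<close>.\<close>

primrec Ck_on :: "nat \<Rightarrow> (real^'n::finite) set \<Rightarrow> (real^'n \<Rightarrow> real) \<Rightarrow> bool" where
  "Ck_on 0 S f \<longleftrightarrow> continuous_on S f"
| "Ck_on (Suc k) S f \<longleftrightarrow>
     (\<forall>x\<in>S. f differentiable at x) \<and> (\<forall>i. Ck_on k S (partial_deriv i f))"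

definition smooth_on :: "(real^'n::finite) set \<Rightarrow> (real^'n \<Rightarrow> real) \<Rightarrow> bool" where
  "smooth_on S f \<longleftrightarrow> (\<forall>k. Ck_on k S f)"

text \<open>Near every boundary point the domain is the sublevel set of a smooth function with
  nonvanishing gradient, so it lies locally on one side of a smooth hypersurface.\<close>

definition smooth_boundary :: "(real^'n::finite) set \<Rightarrow> bool" where
  "smooth_boundary \<Omega> \<longleftrightarrow>
     (\<forall>p\<in>frontier \<Omega>. \<exists>U \<rho>. open U \<and> p \<in> U \<and> smooth_on U \<rho> \<and>
        (\<forall>x\<in>U. gradient \<rho> x \<noteq> 0) \<and> \<Omega> \<inter> U = {x \<in> U. \<rho> x < 0})"

definition smooth_bounded_domain :: "(real^'n::finite) set \<Rightarrow> bool" where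
  "smooth_bounded_domain \<Omega> \<longleftrightarrow>
     open \<Omega> \<and> connected \<Omega> \<and> \<Omega> \<noteq> {} \<and> bounded \<Omega> \<and> smooth_boundary \<Omega>"

section \<open>Surface measure\<close>

text \<open>The \<open>d\<close>-dimensional Hausdorff measure, normalised to agree with \<open>d\<close>-dimensional area on
  smooth submanifolds. The covering sets are required to be bounded because \<open>diameter\<close> is
  meaningless otherwise; the formula is intended for \<open>d \<ge> 1\<close>.\<close>

definition hausdorff_premeasure :: "nat \<Rightarrow> real \<Rightarrow> 'a::metric_space set \<Rightarrow> ennreal" where
  "hausdorff_premeasure d \<delta> A =
     (INF C \<in> {C :: nat \<Rightarrow> 'a set. A \<subseteq> (\<Union>i. C i) \<and> (\<forall>i. bounded (C i) \<and> diameter (C i) \<le> \<delta>)}.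
        \<Sum>i. ennreal (unit_ball_vol (real d) * (diameter (C i) / 2) ^ d))"

definition hausdorff_outer :: "nat \<Rightarrow> 'a::metric_space set \<Rightarrow> ennreal" where
  "hausdorff_outer d A = (SUP \<delta>\<in>{0<..}. hausdorff_premeasure d \<delta> A)"

definition hausdorff_measure :: "nat \<Rightarrow> 'a::metric_space measure" where
  "hausdorff_measure d = measure_of UNIV (sets borel) (hausdorff_outer d)"

definition surface_measure :: "(real^'n::finite) set \<Rightarrow> (real^'n) measure" where
  "surface_measure \<Omega> = restrict_space (hausdorff_measure (CARD('n) - 1)) (frontier \<Omega>)"

section \<open>The Sobolev space \<open>H\<^sup>1\<close> and traces\<close>

definition test_function :: "(real^'n::finite) set \<Rightarrow> (real^'n \<Rightarrow> real) \<Rightarrow> bool" where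
  "test_function \<Omega> \<psi> \<longleftrightarrow>
     smooth_on UNIV \<psi> \<and> compact (closure {x. \<psi> x \<noteq> 0}) \<and> closure {x. \<psi> x \<noteq> 0} \<subseteq> \<Omega>"

text \<open>\<open>u\<close> represents an element of \<open>H\<^sup>1(\<Omega>)\<close> with weak gradient \<open>G\<close> (unique almost everywhere).\<close>

definition H1_with_gradient ::
    "(real^'n::finite) set \<Rightarrow> (real^'n \<Rightarrow> real) \<Rightarrow> (real^'n \<Rightarrow> real^'n) \<Rightarrow> bool" where
  "H1_with_gradient \<Omega> u G \<longleftrightarrow>
     u \<in> borel_measurable (lebesgue_on \<Omega>) \<and> integrable (lebesgue_on \<Omega>) (\<lambda>x. (u x)\<^sup>2) \<and>
     G \<in> borel_measurable (lebesgue_on \<Omega>) \<and> integrable (lebesgue_on \<Omega>) (\<lambda>x. (norm (G x))\<^sup>2) \<and>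
     (\<forall>\<psi> i. test_function \<Omega> \<psi> \<longrightarrow>
        (\<integral>x. u x * partial_deriv i \<psi> x \<partial>lebesgue_on \<Omega>) = - (\<integral>x. G x $ i * \<psi> x \<partial>lebesgue_on \<Omega>))"

text \<open>\<open>g\<close> is the trace on \<open>\<partial>\<Omega>\<close> of \<open>u \<in> H\<^sup>1(\<Omega>)\<close> with weak gradient \<open>G\<close>: the trace operator is the
  continuous extension of restriction to the boundary from the functions smooth up to the
  boundary, which are dense in \<open>H\<^sup>1(\<Omega>)\<close>. On a smooth bounded domain every \<open>u\<close> has a trace, and it is
  unique up to null sets of the surface measure.\<close>

definition has_trace ::
    "(real^'n::finite) set \<Rightarrow> (real^'n \<Rightarrow> real) \<Rightarrow> (real^'n \<Rightarrow> real^'n) \<Rightarrow> (real^'n \<Rightarrow> real) \<Rightarrow> bool" where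
  "has_trace \<Omega> u G g \<longleftrightarrow>
     g \<in> borel_measurable borel \<and>
     (\<exists>f :: nat \<Rightarrow> real^'n \<Rightarrow> real. (\<forall>j. smooth_on UNIV (f j)) \<and>
        (\<lambda>j. \<integral>\<^sup>+x. ennreal ((f j x - u x)\<^sup>2) \<partial>lebesgue_on \<Omega>) \<longlonglongrightarrow> 0 \<and>
        (\<lambda>j. \<integral>\<^sup>+x. ennreal ((norm (gradient (f j) x - G x))\<^sup>2) \<partial>lebesgue_on \<Omega>) \<longlonglongrightarrow> 0 \<and>
        (\<lambda>j. \<integral>\<^sup>+x. ennreal ((f j x - g x)\<^sup>2) \<partial>surface_measure \<Omega>) \<longlonglongrightarrow> 0)"

section \<open>Steklov eigenvalues\<close>

text \<open>The Rayleigh quotient of a function with weak gradient \<open>G\<close> and trace \<open>g\<close>. The case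
  distinction is needed since \<open>0 / 0 = 0\<close> in \<^typ>\<open>ennreal\<close>.\<close>

definition steklov_quotient ::
    "(real^'n::finite) set \<Rightarrow> (real^'n \<Rightarrow> real^'n) \<Rightarrow> (real^'n \<Rightarrow> real) \<Rightarrow> ennreal" where
  "steklov_quotient \<Omega> G g =
     (if (\<integral>\<^sup>+x. ennreal ((g x)\<^sup>2) \<partial>surface_measure \<Omega>) = 0 then top
      else (\<integral>\<^sup>+x. ennreal ((norm (G x))\<^sup>2) \<partial>lebesgue_on \<Omega>) /
           (\<integral>\<^sup>+x. ennreal ((g x)\<^sup>2) \<partial>surface_measure \<Omega>))"

definition lin_indep_ae :: "(real^'n::finite) set \<Rightarrow> nat \<Rightarrow> (nat \<Rightarrow> real^'n \<Rightarrow> real) \<Rightarrow> bool" where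
  "lin_indep_ae \<Omega> k u \<longleftrightarrow>
     (\<forall>c. (AE x in lebesgue_on \<Omega>. (\<Sum>i<k. c i * u i x) = 0) \<longrightarrow> (\<forall>i<k. c i = 0))"

text \<open>The min-max formula for the \<open>k\<close>-th Steklov eigenvalue, \<open>k \<ge> 1\<close>. A \<open>k\<close>-dimensional subspace
  \<open>V\<close> of \<open>H\<^sup>1(\<Omega>)\<close> is given by a basis \<open>u 0, \<dots>, u (k - 1)\<close>, with weak gradients \<open>G i\<close> and traces
  \<open>g i\<close>; the nonzero elements of \<open>V\<close> are the combinations \<open>\<Sum>i<k. c i * u i x\<close> with \<open>c\<close> not zero on
  \<open>{..<k}\<close>, and by linearity their gradients and traces are the corresponding combinations of
  the \<open>G i\<close> and \<open>g i\<close>.\<close>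

definition steklov_eigenvalue :: "(real^'n::finite) set \<Rightarrow> nat \<Rightarrow> ennreal" where
  "steklov_eigenvalue \<Omega> k =
     Inf {(SUP c\<in>{c :: nat \<Rightarrow> real. \<exists>i<k. c i \<noteq> 0}.
             steklov_quotient \<Omega> (\<lambda>x. \<Sum>i<k. c i *\<^sub>R G i x) (\<lambda>x. \<Sum>i<k. c i * g i x))
          | u G g. (\<forall>i<k. H1_with_gradient \<Omega> (u i) (G i) \<and> has_trace \<Omega> (u i) (G i) (g i)) \<and>
                   lin_indep_ae \<Omega> k u}"

end

theory Submission
  imports Defs
begin

text \<open>Divide the space into cubes of side \<open>R\<close>, where \<open>R\<close> is a small constant times
  \<open>|\<Omega>| powr (1 / n) * k powr (- 1 / (n - 1))\<close>, and let \<open>H\<close> be the surface measure. A bump function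
  adapted to a cube \<open>Q\<close> has Rayleigh quotient at most of order \<open>|\<Omega> \<inter> 5Q| / (R\<^sup>2 H(\<partial>\<Omega> \<inter> 3Q))\<close>, so it
  suffices to find \<open>k\<close> cubes with disjoint \<open>5Q\<close> for which \<open>|\<Omega> \<inter> 5Q| \<le> K R H(\<partial>\<Omega> \<inter> 3Q)\<close>. By the relative
  isoperimetric inequality this holds if \<open>\<Omega>\<close> fills at most half of \<open>Q\<close> and \<open>|\<Omega> \<inter> 5Q|\<close> is not much
  larger than \<open>|\<Omega> \<inter> Q|\<close>, and also if \<open>\<Omega>\<close> fills more than half of \<open>Q\<close> but at most half of an
  adjacent cube. The cubes violating the doubling condition carry at most half of the volume. Hence,
  up to constants, either there are \<open>N = |\<Omega>| / R ^ n\<close> cubes of the first kind, or \<open>N\<close> cubes are more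
  than half full, and then the discrete isoperimetric inequality provides \<open>N powr ((n - 1) / n)\<close>, a
  large multiple of \<open>k\<close>, of the second kind.\<close>

section \<open>Smooth bump functions\<close>

text \<open>The bumps have disjoint supports, so numerator and denominator are both additive over a
  linear combination, and a common bound for the single bumps passes to their whole span. The
  doubling condition appears because isoperimetry inside 3Q controls only the volume in Q, while the
  numerator sees all of 5Q. Every point lies in 5 ^ n of the enlarged cubes, so their volumes in
  \<Omega> add up to at most 5 ^ n times that of \<Omega>; hence cubes that fail doubling with the
  factor 2 * 5 ^ n carry at most half of it. A cube more than half full is doubling automatically,
  and what it lacks is a missing part, which the adjacent cube supplies. The surface measure is a
  Hausdorff measure and enters only through lower bounds in the denominator. These are obtained from
  arbitrary countable covers of the frontier, which is why the isoperimetric inequality is derived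
  from covers by a path argument rather than from a divergence theorem. The bumps are smooth on the
  whole space, so each of them is its own trace.\<close>

lemma Ck_on_UNIV_Suc_imp: "Ck_on (Suc k) UNIV f \<Longrightarrow> Ck_on k UNIV f"
proof (induction k arbitrary: f)
  case 0
  then show ?case
    by (simp add: continuous_on_eq_continuous_at differentiable_imp_continuous_within)
next
  case (Suc k)
  then show ?case by (metis Ck_on.simps(2))
qed

lemma partial_deriv_add:
  assumes "f differentiable at x" "g differentiable at x"
  shows "partial_deriv i (\<lambda>x. f x + g x) x = partial_deriv i f x + partial_deriv i g x"
proof -
  have "((\<lambda>x. f x + g x) has_derivative
      (\<lambda>h. frechet_derivative f (at x) h + frechet_derivative g (at x) h)) (at x)"
    using assms by (intro has_derivative_add) (auto simp: frechet_derivative_works)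
  from frechet_derivative_at[OF this] show ?thesis
    by (simp add: partial_deriv_def fun_eq_iff)
qed

lemma partial_deriv_mult:
  assumes "f differentiable at x" "g differentiable at x"
  shows "partial_deriv i (\<lambda>x. f x * g x) x = f x * partial_deriv i g x + partial_deriv i f x * g x"
proof -
  have "((\<lambda>x. f x * g x) has_derivative
      (\<lambda>h. f x * frechet_derivative g (at x) h + frechet_derivative f (at x) h * g x)) (at x)"
    using assms by (intro has_derivative_mult) (auto simp: frechet_derivative_works)
  from frechet_derivative_at[OF this] show ?thesis
    by (simp add: partial_deriv_def fun_eq_iff)
qed

lemma partial_deriv_const [simp]: "partial_deriv i (\<lambda>x. c) = (\<lambda>x. 0)"
  by (simp add: partial_deriv_def fun_eq_iff)

lemma Ck_on_UNIV_const: "Ck_on k UNIV (\<lambda>x. c)"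
  by (induction k arbitrary: c) auto

lemma Ck_on_UNIV_add:
  "Ck_on k UNIV f \<Longrightarrow> Ck_on k UNIV g \<Longrightarrow> Ck_on k UNIV (\<lambda>x. f x + g x)"
proof (induction k arbitrary: f g)
  case 0
  then show ?case by (auto intro: continuous_on_add)
next
  case (Suc k)
  then have "partial_deriv i (\<lambda>x. f x + g x) = (\<lambda>x. partial_deriv i f x + partial_deriv i g x)" for i
    by (auto simp: fun_eq_iff intro!: partial_deriv_add)
  with Suc show ?case by auto
qed

lemma Ck_on_UNIV_mult:
  "Ck_on k UNIV f \<Longrightarrow> Ck_on k UNIV g \<Longrightarrow> Ck_on k UNIV (\<lambda>x. f x * g x)"
proof (induction k arbitrary: f g)
  case 0
  then show ?case by (auto intro: continuous_on_mult)
next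
  case (Suc k)
  then have "partial_deriv i (\<lambda>x. f x * g x) =
      (\<lambda>x. f x * partial_deriv i g x + partial_deriv i f x * g x)" for i
    by (auto simp: fun_eq_iff intro!: partial_deriv_mult)
  moreover have "Ck_on k UNIV f" "Ck_on k UNIV g"
    using Suc.prems Ck_on_UNIV_Suc_imp by blast+
  ultimately show ?case
    using Suc by (auto intro!: Ck_on_UNIV_add)
qed

lemma Ck_on_UNIV_prod:
  "finite I \<Longrightarrow> (\<And>i. i \<in> I \<Longrightarrow> Ck_on k UNIV (f i)) \<Longrightarrow> Ck_on k UNIV (\<lambda>x. \<Prod>i\<in>I. f i x)"
  by (induction I rule: finite_induct) (auto intro!: Ck_on_UNIV_mult Ck_on_UNIV_const)

text \<open>Carrying the power \<open>t ^ k\<close> along makes the family stable under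
  differentiation up to linear combinations, so smoothness of exp (-1/t) follows by a single
  induction with \<open>k\<close> arbitrary.\<close>

definition flat :: "nat \<Rightarrow> real \<Rightarrow> real" where
  "flat k t = (if t > 0 then exp (- (1 / t)) / t ^ k else 0)"

lemma flat_nonneg: "flat k t \<ge> 0"
  by (simp add: flat_def)

text \<open>The single term of index \<open>k + 2\<close> in the series of exp (1/t) already yields
  the bound. Two spare powers of \<open>t\<close> are kept so that the difference quotient at 0 is
  O(|t|), which gives the derivative there.\<close>

lemma flat_le_square: "\<bar>flat k t\<bar> \<le> fact (k + 2) * t\<^sup>2"
proof (cases "t > 0")
  case True
  define c :: real where "c = fact (k + 2)"
  have "c > 0" by (simp add: c_def)
  have "(\<Sum>j\<in>{k+2}. inverse (fact j) *\<^sub>R (1 / t) ^ j) \<le> exp (1 / t)"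
    unfolding exp_def using True
    by (intro sum_le_suminf summable_exp_generic) auto
  then have "inverse c * (1 / t) ^ (k + 2) \<le> exp (1 / t)"
    unfolding c_def by (simp only: sum.insert sum.empty finite.emptyI empty_iff real_scaleR_def)
      simp
  then have "exp (- (1 / t)) \<le> c * t ^ (k + 2)"
    using True \<open>c > 0\<close> by (simp add: exp_minus field_simps)
  then show ?thesis
    unfolding c_def[symmetric]
    using True by (simp add: flat_def divide_simps power_add power2_eq_square mult_ac)
qed (simp add: flat_def)

lemma DERIV_flat: "(flat k has_real_derivative flat (k + 2) t - real k * flat (k + 1) t) (at t)"
proof -
  consider "t > 0" | "t < 0" | "t = 0" by linarith
  then show ?thesis
  proof cases
    case 1
    have "((\<lambda>t. exp (- (1 / t)) / t ^ k) has_real_derivative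
        flat (k + 2) t - real k * flat (k + 1) t) (at t)"
      using 1
      apply (auto intro!: derivative_eq_intros simp: flat_def)
      apply (cases k)
       apply (auto simp: field_simps power2_eq_square power_add)
      done
    then show ?thesis
      using 1 by (elim has_field_derivative_transform_within_open[where S = "{0<..}"])
        (auto simp: flat_def)
  next
    case 2
    have "((\<lambda>t. 0) has_real_derivative flat (k + 2) t - real k * flat (k + 1) t) (at t)"
      using 2 by (simp add: flat_def)
    then show ?thesis
      using 2 by (elim has_field_derivative_transform_within_open[where S = "{..<0}"])
        (auto simp: flat_def)
  next
    case 3
    have "((\<lambda>h. flat k h / h) \<longlongrightarrow> 0) (at 0)"
    proof (rule Lim_null_comparison)
      show "\<forall>\<^sub>F h in at 0. norm (flat k h / h) \<le> fact (k + 2) * \<bar>h\<bar>"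
      proof (rule always_eventually, rule allI)
        fix h :: real
        show "norm (flat k h / h) \<le> fact (k + 2) * \<bar>h\<bar>"
          using flat_le_square[of k h] unfolding power2_abs[of h, symmetric]
          by (cases "h = 0") (simp_all add: abs_divide pos_divide_le_eq power2_eq_square mult.assoc
              del: abs_mult_self_eq)
      qed
      show "((\<lambda>h::real. fact (k + 2) * \<bar>h\<bar>) \<longlongrightarrow> 0) (at 0)"
        by (auto intro!: tendsto_eq_intros)
    qed
    then show ?thesis
      using 3 by (simp add: DERIV_def flat_def)
  qed
qed

lemma partial_deriv_affine:
  assumes "\<And>t. (h has_real_derivative h' t) (at t)"
  shows "(\<lambda>x::real^'n::finite. h (s * x $ j + b)) differentiable at x"
    and "partial_deriv i (\<lambda>x::real^'n. h (s * x $ j + b)) x =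
      (if i = j then s else 0) * h' (s * x $ j + b)"
proof -
  have "((\<lambda>x::real^'n. s * x $ j + b) has_derivative (\<lambda>v. s * v $ j)) (at x)"
    by (auto intro!: derivative_eq_intros bounded_linear.has_derivative[OF bounded_linear_vec_nth])
  from has_derivative_compose[OF this assms[unfolded has_field_derivative_def]]
  have "((\<lambda>x. h (s * x $ j + b)) has_derivative (\<lambda>v. h' (s * x $ j + b) * (s * v $ j))) (at x)" .
  from this frechet_derivative_at[OF this, symmetric]
  show "(\<lambda>x::real^'n::finite. h (s * x $ j + b)) differentiable at x"
    and "partial_deriv i (\<lambda>x::real^'n. h (s * x $ j + b)) x =
      (if i = j then s else 0) * h' (s * x $ j + b)"
    by (auto simp: differentiable_def partial_deriv_def fun_eq_iff axis_def)
qed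

lemma Ck_on_flat_affine: "Ck_on m UNIV (\<lambda>x::real^'n::finite. flat k (s * x $ j + b))"
proof (induction m arbitrary: k)
  case 0
  have "continuous_on UNIV (flat k)"
    using DERIV_flat DERIV_isCont by (metis continuous_at_imp_continuous_on)
  then show ?case
    by (auto intro!: continuous_intros intro: continuous_on_compose2)
next
  case (Suc m)
  have "partial_deriv i (\<lambda>x::real^'n. flat k (s * x $ j + b)) =
     (\<lambda>x. (if i = j then s else 0) *
       (flat (k + 2) (s * x $ j + b) + (- real k) * flat (k + 1) (s * x $ j + b)))" for i
    by (rule ext) (subst partial_deriv_affine(2)[OF DERIV_flat], simp)
  moreover have "Ck_on m UNIV (\<lambda>x::real^'n. (if i = j then s else 0) *
       (flat (k + 2) (s * x $ j + b) + (- real k) * flat (k + 1) (s * x $ j + b)))" for i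
    by (intro Ck_on_UNIV_mult Ck_on_UNIV_const Ck_on_UNIV_add Suc.IH)
  ultimately have "Ck_on m UNIV (partial_deriv i (\<lambda>x::real^'n. flat k (s * x $ j + b)))" for i
    by presburger
  then show ?case
    by (simp add: partial_deriv_affine(1)[OF DERIV_flat])
qed

text \<open>For the unit cube Q = [0,1]^n this is positive exactly on the interior of 5Q, that is
  (-2,3)^n, and therefore bounded below on the compact cube 3Q = [-1,2]^n.\<close>

definition bump :: "real^'n::finite \<Rightarrow> real" where
  "bump y = (\<Prod>j\<in>UNIV. flat 0 (y $ j + 2) * flat 0 (3 - y $ j))"

lemma bump_nonneg: "bump y \<ge> 0"
  by (simp add: bump_def prod_nonneg flat_nonneg)

lemma bump_pos_iff: "bump y > 0 \<longleftrightarrow> (\<forall>j. -2 < y $ j \<and> y $ j < 3)"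
proof -
  have "bump y = 0 \<longleftrightarrow> (\<exists>j. flat 0 (y $ j + 2) * flat 0 (3 - y $ j) = 0)"
    by (simp add: bump_def)
  moreover have "flat 0 (y $ j + 2) * flat 0 (3 - y $ j) = 0 \<longleftrightarrow> \<not> (-2 < y $ j \<and> y $ j < 3)" for j
    by (auto simp: flat_def)
  ultimately show ?thesis
    using bump_nonneg[of y] by (metis less_eq_real_def less_irrefl)
qed

lemma smooth_on_bump:
  fixes p :: "real^'n::finite"
  shows "smooth_on UNIV (\<lambda>x. bump (s *\<^sub>R (x - p)))"
proof -
  have "(\<lambda>x. bump (s *\<^sub>R (x - p))) =
    (\<lambda>x. \<Prod>j\<in>UNIV. flat 0 (s * x $ j + (2 - s * p $ j)) * flat 0 ((- s) * x $ j + (3 + s * p $ j)))"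
    by (simp add: bump_def algebra_simps)
  then show ?thesis
    unfolding smooth_on_def
    by (simp only:) (intro allI Ck_on_UNIV_prod Ck_on_UNIV_mult Ck_on_flat_affine; simp)
qed

section \<open>Functions smooth on the whole space: continuity, products, gradients\<close>

lemma smooth_on_UNIV_differentiable: "smooth_on UNIV u \<Longrightarrow> u differentiable at x"
  unfolding smooth_on_def by (metis Ck_on.simps(2) UNIV_I)

lemma smooth_on_UNIV_continuous: "smooth_on UNIV u \<Longrightarrow> continuous_on UNIV u"
  unfolding smooth_on_def by (metis Ck_on.simps(1))

lemma smooth_on_UNIV_partial_deriv: "smooth_on UNIV u \<Longrightarrow> smooth_on UNIV (partial_deriv i u)"
  unfolding smooth_on_def by (metis Ck_on.simps(2))

lemma smooth_on_UNIV_mult: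
  "smooth_on UNIV f \<Longrightarrow> smooth_on UNIV g \<Longrightarrow> smooth_on UNIV (\<lambda>x. f x * g x)"
  by (simp add: smooth_on_def Ck_on_UNIV_mult)

lemma continuous_on_gradient: "smooth_on UNIV u \<Longrightarrow> continuous_on UNIV (gradient u)"
  unfolding gradient_def
  by (intro continuous_on_vec_lambda smooth_on_UNIV_continuous smooth_on_UNIV_partial_deriv)

text \<open>A zero of a nonnegative function is a minimum. This lets the gradient of a bump be
  handled pointwise on the set where the bump is positive, without discussing the boundary of its
  support.\<close>

lemma gradient_eq_0_at_zero:
  assumes "u differentiable at x" "\<And>y. u y \<ge> 0" "u x = 0"
  shows "gradient u x = 0"
proof -
  have "frechet_derivative u (at x) = (\<lambda>v. 0)"
    using assms by (intro has_derivative_local_min[where f = u and x = x])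
      (auto simp: frechet_derivative_works)
  then show ?thesis
    by (simp add: gradient_def partial_deriv_def vec_eq_iff)
qed

lemma bump_scaled_gradient:
  fixes p :: "real^'n::finite"
  shows "gradient (\<lambda>x. bump (s *\<^sub>R (x - p))) x = s *\<^sub>R gradient bump (s *\<^sub>R (x - p))"
proof -
  have "smooth_on UNIV (bump :: real^'n \<Rightarrow> real)"
    using smooth_on_bump[of 1 0] by simp
  then have "(bump has_derivative frechet_derivative bump (at (s *\<^sub>R (x - p)))) (at (s *\<^sub>R (x - p)))"
    using smooth_on_UNIV_differentiable frechet_derivative_works by blast
  then have "((\<lambda>x. bump (s *\<^sub>R (x - p))) has_derivative
     (\<lambda>v. frechet_derivative bump (at (s *\<^sub>R (x - p))) (s *\<^sub>R v))) (at x)"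
    by (rule has_derivative_compose[rotated]) (auto intro!: derivative_eq_intros)
  from frechet_derivative_at[OF this]
  have "partial_deriv i (\<lambda>x. bump (s *\<^sub>R (x - p))) x = 
     frechet_derivative bump (at (s *\<^sub>R (x - p))) (s *\<^sub>R axis i 1)" for i
    by (simp add: partial_deriv_def fun_eq_iff)
  moreover have "linear (frechet_derivative bump (at (s *\<^sub>R (x - p))))"
    using \<open>smooth_on UNIV bump\<close> smooth_on_UNIV_differentiable linear_frechet_derivative by blast
  ultimately show ?thesis
    by (simp add: gradient_def vec_eq_iff partial_deriv_def linear_scale)
qed

text \<open>Both constants come from compactness: the minimum over [-1,2]^n is positive, and the
  gradient is bounded on [-2,3]^n and zero elsewhere, where the bump vanishes.\<close>

lemma bump_bounds:
  "\<exists>m>0. \<exists>G>0. (\<forall>y::real^'n::finite. (\<forall>j. -1 \<le> y $ j \<and> y $ j \<le> 2) \<longrightarrow> m \<le> bump y) \<and>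
     (\<forall>y::real^'n. norm (gradient bump y) \<le> G)"
proof -
  have sm: "smooth_on UNIV (bump :: real^'n \<Rightarrow> real)"
    using smooth_on_bump[of 1 0] by simp
  let ?K = "cbox (\<chi> i. -1) (\<chi> i. 2) :: (real^'n) set"
  have "(\<chi> i. 0) \<in> ?K" by (simp add: mem_box_cart)
  then obtain z where z: "z \<in> ?K" "\<And>y. y \<in> ?K \<Longrightarrow> bump z \<le> bump y"
    using continuous_attains_inf[of ?K bump]
      continuous_on_subset[OF smooth_on_UNIV_continuous[OF sm], of ?K] compact_cbox by blast
  have "-1 \<le> z $ j \<and> z $ j \<le> 2" for j
    using z(1) by (simp add: mem_box_cart)
  then have "-2 < z $ j \<and> z $ j < 3" for j
    by (smt (verit))
  then have "bump z > 0"
    by (simp add: bump_pos_iff)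
  moreover have "bump z \<le> bump y" if "\<forall>j. -1 \<le> y $ j \<and> y $ j \<le> 2" for y :: "real^'n"
    using z(2)[of y] that by (simp add: mem_box_cart)
  moreover
  let ?L = "cbox (\<chi> i. -2) (\<chi> i. 3) :: (real^'n) set"
  have "bounded (gradient bump ` ?L)"
    by (intro compact_imp_bounded compact_continuous_image compact_cbox
        continuous_on_subset[OF continuous_on_gradient[OF sm]]) auto
  then obtain G where G: "G > 0" "\<And>y. y \<in> ?L \<Longrightarrow> norm (gradient bump y) \<le> G"
    by (auto simp: bounded_pos)
  have "norm (gradient bump y) \<le> G" for y :: "real^'n"
  proof (cases "bump y > 0")
    case True
    then have "y \<in> ?L" by (auto simp: bump_pos_iff mem_box_cart less_imp_le)
    then show ?thesis using G by blast
  next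
    case False
    then have "bump y = 0" using bump_nonneg[of y] by linarith
    then show ?thesis using gradient_eq_0_at_zero[OF smooth_on_UNIV_differentiable[OF sm] bump_nonneg] G by simp
  qed
  ultimately show ?thesis using \<open>G > 0\<close> by blast
qed

section \<open>Smooth functions in the Sobolev space\<close>

lemma integral_lborel_translate: "integral\<^sup>L lborel (\<lambda>x. h (x + a)) = integral\<^sup>L lborel (h :: 'a::euclidean_space \<Rightarrow> real)"
  if "h \<in> borel_measurable borel"
proof -
  have "integral\<^sup>L (distr lborel borel ((+) a)) h = (\<integral>x. h (a + x) \<partial>lborel)"
    using that by (intro integral_distr) auto
  then show ?thesis by (simp add: lborel_distr_plus add.commute)
qed

text \<open>Translation invariance makes every difference quotient \<open>D n\<close> integrate to
  0, and dominated convergence passes to the derivative. Shifts have length at most 1, so the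
  quotients vanish outside the ball of radius \<open>r + 1\<close>, and the intermediate point of
  the mean value theorem stays within radius \<open>r + 2\<close>.\<close>

lemma integral_partial_deriv_eq_0:
  fixes h :: "real^'n::finite \<Rightarrow> real"
  assumes h: "smooth_on UNIV h" and K: "compact K" "\<And>x. x \<notin> K \<Longrightarrow> h x = 0"
  shows "(\<integral>x. partial_deriv i h x \<partial>lborel) = 0"
proof -
  let ?e = "axis i 1 :: real^'n"
  define D where "D n x = real (Suc n) * (h (x + (1 / real (Suc n)) *\<^sub>R ?e) - h x)" for n x
  obtain r where r: "r > 0" "\<And>x. x \<in> K \<Longrightarrow> norm x \<le> r"
    using compact_imp_bounded[OF K(1)] by (auto simp: bounded_pos)
  let ?B = "cball 0 (r + 1) :: (real^'n) set"
  have ch: "continuous_on UNIV h" and cg: "continuous_on UNIV (partial_deriv i h)"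
    using h smooth_on_UNIV_continuous smooth_on_UNIV_partial_deriv by blast+
  have "bounded (partial_deriv i h ` cball 0 (r + 2))"
    by (intro compact_imp_bounded compact_continuous_image compact_cball
        continuous_on_subset[OF cg]) auto
  then obtain M where M: "M > 0" "\<And>x. norm x \<le> r + 2 \<Longrightarrow> \<bar>partial_deriv i h x\<bar> \<le> M"
    by (auto simp: bounded_pos)
  have der: "((\<lambda>t. h (x + t *\<^sub>R ?e)) has_real_derivative partial_deriv i h (x + t *\<^sub>R ?e)) (at t)" for x t
  proof -
    have "(h has_derivative frechet_derivative h (at (x + t *\<^sub>R ?e))) (at (x + t *\<^sub>R ?e))"
      using smooth_on_UNIV_differentiable[OF h] frechet_derivative_works by blast
    moreover have "((\<lambda>t. x + t *\<^sub>R ?e) has_derivative (\<lambda>s. s *\<^sub>R ?e)) (at t)"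
      by (auto intro!: derivative_eq_intros)
    ultimately have "((\<lambda>t. h (x + t *\<^sub>R ?e)) has_derivative
        (\<lambda>s. frechet_derivative h (at (x + t *\<^sub>R ?e)) (s *\<^sub>R ?e))) (at t)"
      using has_derivative_compose by blast
    moreover have "linear (frechet_derivative h (at (x + t *\<^sub>R ?e)))"
      using smooth_on_UNIV_differentiable[OF h] linear_frechet_derivative by blast
    ultimately show ?thesis
      by (simp add: has_field_derivative_def linear_scale partial_deriv_def mult_commute_abs)
  qed
  have "(\<lambda>n. D n x) \<longlonglongrightarrow> partial_deriv i h x" for x
  proof -
    have "((\<lambda>t. (h (x + t *\<^sub>R ?e) - h x) / t) \<longlongrightarrow> partial_deriv i h x) (at 0)"
      using der[of x 0] by (simp add: DERIV_def)
    moreover have "filterlim (\<lambda>n. 1 / real (Suc n)) (at 0) sequentially"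
      using LIMSEQ_Suc[OF lim_1_over_n[where 'a = real]] by (auto simp: filterlim_at)
    ultimately have "(\<lambda>n. (h (x + (1 / real (Suc n)) *\<^sub>R ?e) - h x) / (1 / real (Suc n))) \<longlonglongrightarrow> partial_deriv i h x"
      by (rule filterlim_compose)
    then show ?thesis by (simp add: D_def[abs_def] mult.commute)
  qed
  moreover have bd: "norm (D n x) \<le> indicator ?B x *\<^sub>R M" for n x
  proof (cases "x \<in> ?B")
    case True
    let ?t = "1 / real (Suc n)"
    obtain z where z: "0 < z" "z < ?t"
      "h (x + ?t *\<^sub>R ?e) - h (x + 0 *\<^sub>R ?e) = (?t - 0) * partial_deriv i h (x + z *\<^sub>R ?e)"
      using MVT2[of 0 ?t "\<lambda>t. h (x + t *\<^sub>R ?e)" "\<lambda>t. partial_deriv i h (x + t *\<^sub>R ?e)"] der by auto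
    have "norm (x + z *\<^sub>R ?e) \<le> (r + 1) + z"
      using True z(1) by (intro norm_triangle_le) auto
    also have "\<dots> \<le> r + 2"
    proof -
      have "?t \<le> 1" by simp
      then show ?thesis using z(2) by linarith
    qed
    finally have "\<bar>partial_deriv i h (x + z *\<^sub>R ?e)\<bar> \<le> M" by (rule M)
    then show ?thesis using True z(3) by (simp add: D_def)
  next
    case False
    have "x \<notin> K" using False r by force
    moreover have "x + (1 / real (Suc n)) *\<^sub>R ?e \<notin> K"
    proof
      assume "x + (1 / real (Suc n)) *\<^sub>R ?e \<in> K"
      then have "norm (x + (1 / real (Suc n)) *\<^sub>R ?e) \<le> r" by (rule r)
      moreover have "norm x \<le> norm (x + (1 / real (Suc n)) *\<^sub>R ?e) + norm ((1 / real (Suc n)) *\<^sub>R ?e)"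
        by (metis add_diff_cancel_right' norm_triangle_ineq4)
      moreover have "norm ((1 / real (Suc n)) *\<^sub>R ?e) \<le> 1" by simp
      ultimately have "norm x \<le> r + 1" by linarith
      then show False using False by simp
    qed
    ultimately show ?thesis using K(2) False by (simp add: D_def)
  qed
  moreover have meas: "D n \<in> borel_measurable lborel" for n
    unfolding D_def measurable_lborel2
    by (intro borel_measurable_continuous_onI continuous_intros
        continuous_on_compose2[OF ch]) auto
  moreover have "integrable lborel (\<lambda>x. indicator ?B x *\<^sub>R M)"
    by (intro integrable_scaleR_left integrable_real_indicator emeasure_bounded_finite) auto
  moreover have "partial_deriv i h \<in> borel_measurable lborel"
    using cg by (simp add: borel_measurable_continuous_onI)
  ultimately have "(\<lambda>n. integral\<^sup>L lborel (D n)) \<longlonglongrightarrow> integral\<^sup>L lborel (partial_deriv i h)"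
    by (intro integral_dominated_convergence[where w = "\<lambda>x. indicator ?B x *\<^sub>R M"]) auto
  moreover have "integral\<^sup>L lborel (D n) = 0" for n
  proof -
    have bm: "h \<in> borel_measurable borel" using ch by (rule borel_measurable_continuous_onI)
    have "integrable lborel (\<lambda>x. indicator K x *\<^sub>R h x)"
      by (rule borel_integrable_compact[OF K(1)]) (rule continuous_on_subset[OF ch], simp)
    moreover have "(\<lambda>x. indicator K x *\<^sub>R h x) = h"
      using K(2) by (auto simp: fun_eq_iff indicator_def)
    ultimately have ih: "integrable lborel h" by simp
    then have "integrable lborel (\<lambda>x. h (x + a))" for a
      using integrable_distr_eq[of "(+) a" lborel borel h] bm
      by (simp add: lborel_distr_plus add.commute)
    then show ?thesis
      unfolding D_def using ih integral_lborel_translate[OF bm] by simp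
  qed
  ultimately show ?thesis by (simp add: LIMSEQ_const_iff)
qed

text \<open>Integration by parts: the product of \<open>u\<close> with a test function is smooth
  with compact support inside \<Omega>, so the integral of its partial derivative over the whole
  space vanishes, and that integral only sees \<Omega>. Square integrability follows from continuity
  on the compact closure.\<close>

lemma H1_with_gradient_smooth:
  fixes u :: "real^'n::finite \<Rightarrow> real"
  assumes u: "smooth_on UNIV u" and S: "open \<Omega>" "bounded \<Omega>"
  shows "H1_with_gradient \<Omega> u (gradient u)"
proof -
  have meas: "f \<in> borel_measurable (lebesgue_on \<Omega>)" if "continuous_on UNIV f" for f :: "real^'n \<Rightarrow> 'b::euclidean_space"
    using borel_measurable_continuous_onI[OF that]
    by (metis measurable_completion measurable_lborel2 measurable_restrict_space1)
  have So: "\<Omega> \<in> lmeasurable" "\<Omega> \<in> sets lebesgue"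
    using lmeasurable_open[OF S(2,1)] by auto
  have int: "integrable (lebesgue_on \<Omega>) f" if "continuous_on UNIV f" for f :: "real^'n \<Rightarrow> real"
  proof -
    have "bounded (f ` closure \<Omega>)"
      using S by (intro compact_imp_bounded compact_continuous_image
          continuous_on_subset[OF that]) auto
    then obtain M where "\<And>x. x \<in> \<Omega> \<Longrightarrow> norm (f x) \<le> M"
      using closure_subset by (force simp: bounded_iff)
    moreover have "finite_measure (lebesgue_on \<Omega>)"
      using So by (simp add: finite_measure_lebesgue_on)
    ultimately show ?thesis
      using meas[OF that] So
      by (intro finite_measure.integrable_const_bound[where B = M]) (auto simp: AE_restrict_space_iff)
  qed
  have parts: "(\<integral>x. u x * partial_deriv i \<psi> x \<partial>lebesgue_on \<Omega>) = - (\<integral>x. gradient u x $ i * \<psi> x \<partial>lebesgue_on \<Omega>)"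
    if psi: "test_function \<Omega> \<psi>" for \<psi> i
  proof -
    define Z where "Z = closure {x. \<psi> x \<noteq> 0}"
    have sp: "smooth_on UNIV \<psi>" and K: "compact Z" "Z \<subseteq> \<Omega>"
      using psi by (auto simp: test_function_def Z_def)
    have zero: "\<psi> x = 0" if "x \<notin> Z" for x
      using that closure_subset[of "{x. \<psi> x \<noteq> 0}"] unfolding Z_def by auto
    have zero': "partial_deriv i \<psi> x = 0" if "x \<notin> Z" for x
    proof -
      have "((\<lambda>x. 0) has_derivative (\<lambda>v. 0)) (at x)" by simp
      then have "(\<psi> has_derivative (\<lambda>v. 0)) (at x)"
        by (rule has_derivative_transform_within_open[of _ _ _ _ "- Z"]) (use that zero K in \<open>auto intro: compact_imp_closed\<close>)
      from frechet_derivative_at[OF this] show ?thesis by (simp add: partial_deriv_def fun_eq_iff)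
    qed
    have c: "continuous_on UNIV (\<lambda>x. u x * partial_deriv i \<psi> x)"
        "continuous_on UNIV (\<lambda>x. partial_deriv i u x * \<psi> x)"
      by (intro continuous_intros smooth_on_UNIV_continuous smooth_on_UNIV_partial_deriv u sp)+
    have to_lborel: "(\<integral>x. f x \<partial>lebesgue_on \<Omega>) = (\<integral>x. f x \<partial>lborel)"
      if "continuous_on UNIV f" "\<And>x. x \<notin> Z \<Longrightarrow> f x = 0" for f :: "real^'n \<Rightarrow> real"
    proof -
      have "(\<integral>x. f x \<partial>lebesgue_on \<Omega>) = (\<integral>x. indicator \<Omega> x *\<^sub>R f x \<partial>lebesgue)"
        using So by (intro integral_restrict_space) simp
      also have "(\<lambda>x. indicator \<Omega> x *\<^sub>R f x) = f"
        using that(2) K(2) by (auto simp: fun_eq_iff indicator_def)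
      finally show ?thesis
        using borel_measurable_continuous_onI[OF that(1)] by (simp add: integral_completion)
    qed
    have "(\<integral>x. partial_deriv i (\<lambda>x. u x * \<psi> x) x \<partial>lborel) = 0"
      using u sp K zero by (intro integral_partial_deriv_eq_0[of _ Z] smooth_on_UNIV_mult) auto
    also have "partial_deriv i (\<lambda>x. u x * \<psi> x) = (\<lambda>x. u x * partial_deriv i \<psi> x + partial_deriv i u x * \<psi> x)"
      using u sp by (auto simp: fun_eq_iff smooth_on_UNIV_differentiable intro!: partial_deriv_mult)
    also have "(\<integral>x. u x * partial_deriv i \<psi> x + partial_deriv i u x * \<psi> x \<partial>lborel) =
      (\<integral>x. u x * partial_deriv i \<psi> x + partial_deriv i u x * \<psi> x \<partial>lebesgue_on \<Omega>)"
      by (rule to_lborel[symmetric]) (use c zero zero' in \<open>auto intro: continuous_on_add\<close>)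
    also have "\<dots> = (\<integral>x. u x * partial_deriv i \<psi> x \<partial>lebesgue_on \<Omega>) + (\<integral>x. partial_deriv i u x * \<psi> x \<partial>lebesgue_on \<Omega>)"
      by (intro Bochner_Integration.integral_add int c)
    finally show ?thesis by (simp add: gradient_def)
  qed
  have cu: "continuous_on UNIV u" and cg: "continuous_on UNIV (gradient u)"
    using u by (auto intro: smooth_on_UNIV_continuous continuous_on_gradient)
  have "continuous_on UNIV (\<lambda>x. (u x)\<^sup>2)" "continuous_on UNIV (\<lambda>x. (norm (gradient u x))\<^sup>2)"
    by (intro continuous_intros cu cg)+
  with parts show ?thesis
    unfolding H1_with_gradient_def by (auto intro!: meas int cu cg)
qed

text \<open>The constant sequence approximates \<open>u\<close>, so all three error integrals are
  0.\<close>

lemma has_trace_smooth: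
  fixes u :: "real^'n::finite \<Rightarrow> real"
  assumes "smooth_on UNIV u"
  shows "has_trace \<Omega> u (gradient u) u"
  unfolding has_trace_def
  using assms
  by (intro conjI exI[of _ "\<lambda>_. u"])
    (auto intro!: borel_measurable_continuous_onI smooth_on_UNIV_continuous)

section \<open>Hausdorff measure\<close>

lemma hausdorff_premeasure_le:
  assumes "A \<subseteq> (\<Union>i. C i)" "\<And>i. bounded (C i)" "\<And>i. diameter (C i) \<le> \<delta>"
  shows "hausdorff_premeasure d \<delta> A \<le> (\<Sum>i. ennreal (unit_ball_vol (real d) * (diameter (C i) / 2) ^ d))"
  unfolding hausdorff_premeasure_def using assms by (intro INF_lower2[of C]) auto

lemma hausdorff_premeasure_mono: "A \<subseteq> B \<Longrightarrow> hausdorff_premeasure d \<delta> A \<le> hausdorff_premeasure d \<delta> B"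
  unfolding hausdorff_premeasure_def by (intro INF_superset_mono) auto

lemma hausdorff_premeasure_antimono: "\<delta> \<le> \<delta>' \<Longrightarrow> hausdorff_premeasure d \<delta>' A \<le> hausdorff_premeasure d \<delta> A"
  unfolding hausdorff_premeasure_def by (intro INF_superset_mono) (auto intro: order_trans)

lemma hausdorff_premeasure_empty: "d \<ge> 1 \<Longrightarrow> \<delta> > 0 \<Longrightarrow> hausdorff_premeasure d \<delta> {} = 0"
  using hausdorff_premeasure_le[of "{}" "\<lambda>_. {}" \<delta> d] by (simp add: power_0_left)

lemma hausdorff_premeasure_UN:
  assumes "d \<ge> 1"
  shows "hausdorff_premeasure d \<delta> (\<Union>j. A j) \<le> (\<Sum>j::nat. hausdorff_premeasure d \<delta> (A j))"
proof (rule ennreal_le_epsilon)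
  fix e :: real
  assume e: "e > 0" and fin: "(\<Sum>j. hausdorff_premeasure d \<delta> (A j)) < top"
  let ?w = "\<lambda>C. ennreal (unit_ball_vol (real d) * (diameter C / 2) ^ d)"
  have "\<exists>C. A j \<subseteq> (\<Union>i. C i) \<and> (\<forall>i. bounded (C i) \<and> diameter (C i) \<le> \<delta>) \<and>
      (\<Sum>i. ?w (C i)) \<le> hausdorff_premeasure d \<delta> (A j) + ennreal (e * (1/2) ^ Suc j)" for j
  proof -
    let ?h = "hausdorff_premeasure d \<delta> (A j)"
    have "?h < top"
      by (rule ennreal_suminf_lessD[OF fin])
    moreover have "0 < ennreal (e * (1/2) ^ Suc j)"
      using e by simp
    ultimately have "?h < ?h + ennreal (e * (1/2) ^ Suc j)"
      using ennreal_add_left_cancel_less[of ?h 0] by simp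
    then obtain C where "A j \<subseteq> (\<Union>i. C i) \<and> (\<forall>i. bounded (C i) \<and> diameter (C i) \<le> \<delta>)"
      "(\<Sum>i. ?w (C i)) < ?h + ennreal (e * (1/2) ^ Suc j)"
      unfolding hausdorff_premeasure_def[of d \<delta> "A j"] INF_less_iff by blast
    then show ?thesis by (intro exI[of _ C]) auto
  qed
  then obtain C where C: "\<And>j. A j \<subseteq> (\<Union>i. C j i)" "\<And>i j. bounded (C j i)" "\<And>i j. diameter (C j i) \<le> \<delta>"
    "\<And>j. (\<Sum>i. ?w (C j i)) \<le> hausdorff_premeasure d \<delta> (A j) + ennreal (e * (1/2) ^ Suc j)"
    by metis
  let ?D = "\<lambda>k. case prod_decode k of (j, i) \<Rightarrow> C j i"
  have "hausdorff_premeasure d \<delta> (\<Union>j. A j) \<le> (\<Sum>k. ?w (?D k))"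
  proof (rule hausdorff_premeasure_le)
    show "(\<Union>j. A j) \<subseteq> (\<Union>k. ?D k)"
    proof
      fix x assume "x \<in> (\<Union>j. A j)"
      then obtain j i where "x \<in> C j i" using C(1) by blast
      then have "x \<in> ?D (prod_encode (j, i))" by simp
      then show "x \<in> (\<Union>k. ?D k)" by (rule UN_I[OF UNIV_I])
    qed
  qed (use C in \<open>auto split: prod.split\<close>)
  also have "\<dots> = (\<Sum>k. case_prod (\<lambda>j i. ?w (C j i)) (prod_decode k))"
    by (simp add: split_beta)
  also have "\<dots> = (\<Sum>j. \<Sum>i. ?w (C j i))"
    by (rule suminf_ennreal_2dimen[unfolded comp_def]) simp
  also have "\<dots> \<le> (\<Sum>j. hausdorff_premeasure d \<delta> (A j) + ennreal (e * (1/2) ^ Suc j))"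
    by (intro suminf_le C(4)) auto
  also have "\<dots> = (\<Sum>j. hausdorff_premeasure d \<delta> (A j)) + (\<Sum>j. ennreal (e * (1/2) ^ Suc j))"
    by (intro suminf_add[symmetric]) auto
  also have "(\<Sum>j. ennreal (e * (1/2) ^ Suc j)) = ennreal e"
    using sums_mult[OF power_half_series, of e] e
    by (subst suminf_ennreal_eq[where x = e]) auto
  finally show "hausdorff_premeasure d \<delta> (\<Union>j. A j) \<le> (\<Sum>j. hausdorff_premeasure d \<delta> (A j)) + ennreal e" .
qed

text \<open>A covering set of diameter at most \<delta> < \<open>e\<close> meets at most one of
  \<open>A\<close> and \<open>B\<close>, so a cover of the union splits into covers of the two
  pieces. \<open>P X i\<close> discards the sets that miss \<open>X\<close> by replacing them with
  {}, whose cost is 0 because \<open>d \<ge> 1\<close>.\<close>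

lemma hausdorff_premeasure_Un_separated:
  assumes "d \<ge> 1" "0 < \<delta>" "\<delta> < e" "\<And>a b. a \<in> A \<Longrightarrow> b \<in> B \<Longrightarrow> e \<le> dist a b"
  shows "hausdorff_premeasure d \<delta> A + hausdorff_premeasure d \<delta> B \<le> hausdorff_premeasure d \<delta> (A \<union> B)"
proof -
  let ?w = "\<lambda>C. ennreal (unit_ball_vol (real d) * (diameter C / 2) ^ d)"
  show ?thesis
    unfolding hausdorff_premeasure_def[of d \<delta> "A \<union> B"]
  proof (rule INF_greatest, clarify)
    fix C :: "nat \<Rightarrow> 'a set"
    assume C: "A \<union> B \<subseteq> (\<Union>i. C i)" "\<forall>i. bounded (C i) \<and> diameter (C i) \<le> \<delta>"
    define P where "P X i = (if C i \<inter> X = {} then {} else C i)" for X i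
    have P: "hausdorff_premeasure d \<delta> X \<le> (\<Sum>i. ?w (P X i))" if X: "X \<subseteq> A \<union> B" for X
    proof (rule hausdorff_premeasure_le)
      show "X \<subseteq> (\<Union>i. P X i)"
      proof
        fix x assume "x \<in> X"
        then obtain i where "x \<in> C i" using C(1) X by blast
        with \<open>x \<in> X\<close> have "x \<in> P X i" by (auto simp: P_def)
        then show "x \<in> (\<Union>i. P X i)" by blast
      qed
    qed (use C(2) assms(2) in \<open>auto simp: P_def\<close>)
    have "?w (P A i) + ?w (P B i) \<le> ?w (C i)" for i
    proof -
      have "C i \<inter> A = {} \<or> C i \<inter> B = {}"
      proof (rule ccontr)
        assume "\<not> ?thesis"
        then obtain a b where "a \<in> C i" "a \<in> A" "b \<in> C i" "b \<in> B" by blast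
        then have "e \<le> diameter (C i)"
          using C(2) assms(4) diameter_bounded_bound by (metis order_trans)
        then show False using C(2) assms(3) by (meson less_le_trans not_le order_trans)
      qed
      then show ?thesis using assms(1) by (auto simp: P_def power_0_left)
    qed
    then have "(\<Sum>i. ?w (P A i) + ?w (P B i)) \<le> (\<Sum>i. ?w (C i))"
      by (intro suminf_le) auto
    then have "(\<Sum>i. ?w (P A i)) + (\<Sum>i. ?w (P B i)) \<le> (\<Sum>i. ?w (C i))"
      by (subst suminf_add) auto
    then show "hausdorff_premeasure d \<delta> A + hausdorff_premeasure d \<delta> B \<le> (\<Sum>i. ?w (C i))"
      using add_mono[OF P[of A] P[of B]] by simp
  qed
qed

section \<open>From the premeasures to a metric outer measure\<close>

lemma hausdorff_outer_mono: "A \<subseteq> B \<Longrightarrow> hausdorff_outer d A \<le> hausdorff_outer d B"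
  unfolding hausdorff_outer_def by (intro SUP_mono) (auto intro: hausdorff_premeasure_mono)

lemma hausdorff_premeasure_le_outer: "\<delta> > 0 \<Longrightarrow> hausdorff_premeasure d \<delta> A \<le> hausdorff_outer d A"
  unfolding hausdorff_outer_def by (intro SUP_upper) auto

lemma hausdorff_outer_empty: "d \<ge> 1 \<Longrightarrow> hausdorff_outer d {} = 0"
  unfolding hausdorff_outer_def by (simp add: hausdorff_premeasure_empty)

lemma hausdorff_outer_UN:
  assumes "d \<ge> 1"
  shows "hausdorff_outer d (\<Union>j. A j) \<le> (\<Sum>j::nat. hausdorff_outer d (A j))"
  unfolding hausdorff_outer_def[of d "\<Union>j. A j"]
proof (rule SUP_least)
  fix \<delta> :: real assume "\<delta> \<in> {0<..}"
  have "hausdorff_premeasure d \<delta> (\<Union>j. A j) \<le> (\<Sum>j. hausdorff_premeasure d \<delta> (A j))"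
    by (rule hausdorff_premeasure_UN[OF assms])
  also have "\<dots> \<le> (\<Sum>j. hausdorff_outer d (A j))"
    using \<open>\<delta> \<in> {0<..}\<close> by (intro suminf_le hausdorff_premeasure_le_outer) auto
  finally show "hausdorff_premeasure d \<delta> (\<Union>j. A j) \<le> (\<Sum>j. hausdorff_outer d (A j))" .
qed

lemma hausdorff_outer_Un:
  assumes "d \<ge> 1"
  shows "hausdorff_outer d (A \<union> B) \<le> hausdorff_outer d A + hausdorff_outer d B"
proof -
  have "hausdorff_outer d (\<Union>j::nat. if j = 0 then A else if j = 1 then B else {})
      \<le> (\<Sum>j::nat. hausdorff_outer d (if j = 0 then A else if j = 1 then B else {}))"
    by (rule hausdorff_outer_UN[OF assms])
  also have "\<dots> = (\<Sum>j\<in>{0,1::nat}. hausdorff_outer d (if j = 0 then A else if j = 1 then B else {}))"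
    using assms by (intro suminf_finite) (auto simp: hausdorff_outer_empty)
  also have "(\<Union>j::nat. if j = 0 then A else if j = 1 then B else {}) = A \<union> B"
    by (auto split: if_splits)
  finally show ?thesis by simp
qed

lemma hausdorff_outer_Un_separated:
  assumes "d \<ge> 1" "0 < e" "\<And>a b. a \<in> A \<Longrightarrow> b \<in> B \<Longrightarrow> e \<le> dist a b"
  shows "hausdorff_outer d A + hausdorff_outer d B \<le> hausdorff_outer d (A \<union> B)"
proof -
  \<comment> \<open>The supremum is rewritten along the scales 1 / (n + 1), because suprema of
    increasing sequences add up in \<open>ennreal\<close>.\<close>
  have eq: "hausdorff_outer d X = (SUP n. hausdorff_premeasure d (1 / real (Suc n)) X)" for X :: "'a set"
  proof (rule antisym)
    show "hausdorff_outer d X \<le> (SUP n. hausdorff_premeasure d (1 / real (Suc n)) X)"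
      unfolding hausdorff_outer_def
    proof (rule SUP_least)
      fix \<delta> :: real assume "\<delta> \<in> {0<..}"
      then obtain n where "1 / real (Suc n) < \<delta>" using nat_approx_posE by auto
      then show "hausdorff_premeasure d \<delta> X \<le> (SUP n. hausdorff_premeasure d (1 / real (Suc n)) X)"
        by (intro SUP_upper2[of n] hausdorff_premeasure_antimono) auto
    qed
  qed (auto intro!: SUP_least hausdorff_premeasure_le_outer)
  have inc: "incseq (\<lambda>n. hausdorff_premeasure d (1 / real (Suc n)) X)" for X :: "'a set"
    by (intro incseq_SucI hausdorff_premeasure_antimono) (simp add: frac_le)
  have "hausdorff_outer d A + hausdorff_outer d B =
      (SUP n. hausdorff_premeasure d (1 / real (Suc n)) A + hausdorff_premeasure d (1 / real (Suc n)) B)"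
    unfolding eq by (intro ennreal_SUP_add[symmetric] inc)
  also have "\<dots> \<le> hausdorff_outer d (A \<union> B)"
  proof (rule SUP_least)
    fix n
    define \<delta> where "\<delta> = min (1 / real (Suc n)) (e / 2)"
    have \<delta>: "0 < \<delta>" "\<delta> < e" "\<delta> \<le> 1 / real (Suc n)" using assms(2) by (auto simp: \<delta>_def min_def)
    have "hausdorff_premeasure d (1 / real (Suc n)) A + hausdorff_premeasure d (1 / real (Suc n)) B
       \<le> hausdorff_premeasure d \<delta> A + hausdorff_premeasure d \<delta> B"
      using \<delta> by (intro add_mono hausdorff_premeasure_antimono)
    also have "\<dots> \<le> hausdorff_premeasure d \<delta> (A \<union> B)"
      using \<delta> assms by (intro hausdorff_premeasure_Un_separated[where e = e]) auto
    also have "\<dots> \<le> hausdorff_outer d (A \<union> B)"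
      by (rule hausdorff_premeasure_le_outer[OF \<delta>(1)])
    finally show "hausdorff_premeasure d (1 / real (Suc n)) A + hausdorff_premeasure d (1 / real (Suc n)) B
       \<le> hausdorff_outer d (A \<union> B)" .
  qed
  finally show ?thesis .
qed

text \<open>Caratheodory's criterion for metric outer measures. \<open>E n\<close> has positive
  distance from \<open>F\<close>, so additivity holds for it; the rest of \<open>T - F\<close> is
  cut into the shells \<open>D k\<close>, k >= n. Shells of equal parity are separated from each
  other, hence the measures of all shells sum to at most twice that of \<open>T\<close>, and the
  tails vanish as n grows.\<close>

lemma hausdorff_outer_closed_split:
  assumes d: "d \<ge> 1" and F: "closed F" "F \<noteq> {}"
  shows "hausdorff_outer d (T \<inter> F) + hausdorff_outer d (T - F) \<le> hausdorff_outer d T"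
proof (cases "hausdorff_outer d T = top")
  case False
  define E where "E n = {x \<in> T. 1 / real (n + 1) \<le> infdist x F}" for n :: nat
  define D where "D n = {x \<in> T. 1 / real (n + 2) \<le> infdist x F \<and> infdist x F < 1 / real (n + 1)}" for n :: nat
  define a where "a n = hausdorff_outer d (D n)" for n
  have split: "T - F \<subseteq> E n \<union> (\<Union>k. D (k + n))" for n
  proof
    fix x assume x: "x \<in> T - F"
    then have "infdist x F > 0"
      using F in_closed_iff_infdist_zero infdist_nonneg by (metis DiffE less_eq_real_def)
    then obtain m where m: "1 / real (Suc m) < infdist x F" using nat_approx_posE by blast
    show "x \<in> E n \<union> (\<Union>k. D (k + n))"
    proof (cases "1 / real (n + 1) \<le> infdist x F")
      case True
      then show ?thesis using x by (simp add: E_def)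
    next
      case n: False
      \<comment> \<open>Minimality gives 1 / (l + 1) <= \<open>infdist x F\<close> < 1 / l, so
        \<open>x\<close> lies in the shell of index \<open>l - 1\<close>, which is at least
        \<open>n\<close>.\<close>
      define l where "l = (LEAST l. 1 / real (l + 1) \<le> infdist x F)"
      have l: "1 / real (l + 1) \<le> infdist x F"
        unfolding l_def by (rule LeastI[of _ m]) (use m in simp)
      have nl: "n < l"
      proof (rule ccontr)
        assume "\<not> n < l"
        then have "1 / real (n + 1) \<le> 1 / real (l + 1)" by (simp add: frac_le)
        then show False using l n by linarith
      qed
      then have "\<not> 1 / real ((l - 1) + 1) \<le> infdist x F"
        unfolding l_def by (intro not_less_Least) simp
      then have "x \<in> D ((l - 1 - n) + n)" using x l nl by (auto simp: D_def)
      then show ?thesis by blast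
    qed
  qed
  have far: "\<bar>infdist x F - infdist y F\<bar> \<le> dist x y" for x y :: 'a
    using infdist_triangle[of x F y] infdist_triangle[of y F x] by (simp add: dist_commute)
  have TE: "hausdorff_outer d (T \<inter> F) + hausdorff_outer d (E n) \<le> hausdorff_outer d T" for n
  proof -
    have "hausdorff_outer d (T \<inter> F) + hausdorff_outer d (E n) \<le> hausdorff_outer d ((T \<inter> F) \<union> E n)"
    proof (rule hausdorff_outer_Un_separated[OF d, of "1 / real (n + 1)"])
      fix a b assume "a \<in> T \<inter> F" "b \<in> E n"
      then show "1 / real (n + 1) \<le> dist a b" using far[of a b] infdist_nonneg[of b F] by (simp add: E_def)
    qed simp
    also have "\<dots> \<le> hausdorff_outer d T" by (rule hausdorff_outer_mono) (auto simp: E_def)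
    finally show ?thesis .
  qed
  have parity: "(\<Sum>k<m. a (2 * k + p)) \<le> hausdorff_outer d (\<Union>k<m. D (2 * k + p))" for m p
  proof (induction m)
    case (Suc m)
    have "(\<Sum>k<Suc m. a (2 * k + p)) \<le> hausdorff_outer d (\<Union>k<m. D (2 * k + p)) + hausdorff_outer d (D (2 * m + p))"
      using Suc by (simp add: a_def add_right_mono)
    also have "\<dots> \<le> hausdorff_outer d ((\<Union>k<m. D (2 * k + p)) \<union> D (2 * m + p))"
    \<comment> \<open>The new shell lies within 1 / (2m + p + 1) of \<open>F\<close>, the earlier
      ones at distance at least 1 / (2m + p), because a shell of the other parity lies between. For
      \<open>m = 0\<close> there is no earlier shell, and the gap need not be positive.\<close>
    proof (cases "m = 0")
      case False
      show ?thesis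
      proof (rule hausdorff_outer_Un_separated[OF d, of "1 / real (2 * m + p) - 1 / real (2 * m + p + 1)"])
        show "0 < 1 / real (2 * m + p) - 1 / real (2 * m + p + 1)" using False
          by (subst diff_gt_0_iff_gt, intro divide_strict_left_mono) auto
        fix x y assume "x \<in> (\<Union>k<m. D (2 * k + p))" and y: "y \<in> D (2 * m + p)"
        then obtain k where k: "k < m" "1 / real (2 * k + p + 2) \<le> infdist x F" by (auto simp: D_def)
        have "1 / real (2 * m + p) \<le> 1 / real (2 * k + p + 2)" using k(1) by (intro divide_left_mono) auto
        moreover have "infdist y F < 1 / real (2 * m + p + 1)" using y by (simp add: D_def)
        ultimately show "1 / real (2 * m + p) - 1 / real (2 * m + p + 1) \<le> dist x y"
          using k(2) far[of x y] by linarith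
      qed
    qed (simp add: hausdorff_outer_empty[OF d])
    also have "(\<Union>k<m. D (2 * k + p)) \<union> D (2 * m + p) = (\<Union>k<Suc m. D (2 * k + p))"
      by (auto simp: lessThan_Suc)
    finally show ?case .
  qed simp
  have fin: "(\<Sum>k. a k) \<noteq> top"
  proof -
    have "(\<Sum>k<n. a k) \<le> 2 * hausdorff_outer d T" for n
    proof -
      have "(\<Sum>k<n. a k) \<le> (\<Sum>k<2 * n. a k)" by (intro sum_mono2) auto
      also have "(\<Sum>k<2 * n. a k) = (\<Sum>k<n. a (2 * k + 0)) + (\<Sum>k<n. a (2 * k + 1))"
        by (induction n) (simp_all add: algebra_simps)
      also have "\<dots> \<le> hausdorff_outer d T + hausdorff_outer d T"
        by (intro add_mono order_trans[OF parity hausdorff_outer_mono]) (auto simp: D_def)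
      finally show ?thesis by (simp add: mult_2)
    qed
    then have "(\<Sum>k. a k) \<le> 2 * hausdorff_outer d T"
      by (intro suminf_le_const) auto
    also have "\<dots> < top" using False by (simp add: ennreal_mult_less_top less_top)
    finally show ?thesis by simp
  qed
  have bound: "hausdorff_outer d (T \<inter> F) + hausdorff_outer d (T - F) \<le> hausdorff_outer d T + ((\<Sum>k. a k) - (\<Sum>k<n. a k))" for n
  proof -
    have "hausdorff_outer d (T - F) \<le> hausdorff_outer d (E n) + hausdorff_outer d (\<Union>k. D (k + n))"
      using hausdorff_outer_mono[OF split] hausdorff_outer_Un[OF d] by (rule order_trans)
    also have "\<dots> \<le> hausdorff_outer d (E n) + (\<Sum>k. a (k + n))"
      unfolding a_def by (intro add_left_mono hausdorff_outer_UN[OF d])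
    also have "(\<Sum>k. a (k + n)) = (\<Sum>k. a k) - (\<Sum>k<n. a k)"
    proof -
      have "(\<Sum>k. a k) = (\<Sum>k. a (k + n)) + (\<Sum>k<n. a k)"
        by (rule suminf_offset) auto
      moreover have "(\<Sum>k<n. a k) \<noteq> top"
        by (rule neq_top_trans[OF fin sum_le_suminf]) auto
      ultimately show ?thesis by (simp add: ennreal_add_diff_cancel_right)
    qed
    finally have "hausdorff_outer d (T \<inter> F) + hausdorff_outer d (T - F)
      \<le> (hausdorff_outer d (T \<inter> F) + hausdorff_outer d (E n)) + ((\<Sum>k. a k) - (\<Sum>k<n. a k))"
      by (simp add: add.assoc add_left_mono)
    also have "\<dots> \<le> hausdorff_outer d T + ((\<Sum>k. a k) - (\<Sum>k<n. a k))"
      by (intro add_right_mono TE)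
    finally show ?thesis .
  qed
  \<comment> \<open>Subtraction in \<open>ennreal\<close> is continuous here only because the series
    of shells is finite.\<close>
  have "(\<lambda>n. hausdorff_outer d T + ((\<Sum>k. a k) - (\<Sum>k<n. a k)))
     \<longlonglongrightarrow> hausdorff_outer d T + ((\<Sum>k. a k) - (\<Sum>k. a k))"
    using fin by (intro tendsto_add tendsto_const tendsto_diff_ennreal summable_LIMSEQ) auto
  then have "(\<lambda>n. hausdorff_outer d T + ((\<Sum>k. a k) - (\<Sum>k<n. a k))) \<longlonglongrightarrow> hausdorff_outer d T"
    using fin by (simp add: ennreal_minus_eq_0)
  then show ?thesis
    by (rule LIMSEQ_le_const) (use bound in auto)
qed simp

text \<open>\<open>measure_of\<close> returns the zero measure unless it is given a genuine measure,
  so countable additivity on the Borel sets has to be proved. The Caratheodory-measurable sets form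
  a sigma-algebra on which the outer measure is additive, and it contains the closed sets by the
  splitting lemma.\<close>

lemma emeasure_hausdorff_measure:
  fixes A :: "'a::metric_space set"
  assumes d: "d \<ge> 1" and A: "A \<in> sets borel"
  shows "emeasure (hausdorff_measure d) A = hausdorff_outer d A"
proof -
  interpret pow: sigma_algebra "UNIV :: 'a set" "Pow UNIV" by (rule sigma_algebra_Pow)
  let ?L = "lambda_system UNIV (Pow UNIV) (hausdorff_outer d :: 'a set \<Rightarrow> ennreal)"
  have "outer_measure_space (Pow UNIV) (hausdorff_outer d :: 'a set \<Rightarrow> ennreal)"
    using d by (auto simp: outer_measure_space_def positive_def increasing_def
        countably_subadditive_def hausdorff_outer_empty hausdorff_outer_mono hausdorff_outer_UN)
  then have ms: "measure_space UNIV ?L (hausdorff_outer d)"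
    by (rule pow.caratheodory_lemma)
  then interpret L: sigma_algebra UNIV ?L by (simp add: measure_space_def)
  have "F \<in> ?L" if "closed F" for F :: "'a set"
  proof (cases "F = {}")
    case False
    have "hausdorff_outer d (T \<inter> F) + hausdorff_outer d (T - F) = hausdorff_outer d T" for T
      using hausdorff_outer_closed_split[OF d that False, of T] hausdorff_outer_Un[OF d, of "T \<inter> F" "T - F"]
      by (simp add: Int_Diff_Un)
    moreover have "(UNIV - F) \<inter> T = T - F" "F \<inter> T = T \<inter> F" for T by auto
    ultimately show ?thesis by (simp add: lambda_system_def del: Diff_UNIV)
  qed (use L.empty_sets in blast)
  then have "sigma_sets UNIV (Collect closed) \<subseteq> ?L"
    by (intro L.sigma_sets_subset) auto
  then have "sets (borel :: 'a measure) \<subseteq> ?L"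
    by (simp add: borel_eq_closed)
  from measure_down[OF ms _ this]
  have "measure_space UNIV (sets borel) (hausdorff_outer d :: 'a set \<Rightarrow> ennreal)"
    using sets.sigma_algebra_axioms[of "borel :: 'a measure"] unfolding space_borel by blast
  then show ?thesis
    unfolding hausdorff_measure_def using A
    by (intro emeasure_measure_of_sigma) (auto simp: measure_space_def)
qed

lemma sets_hausdorff_measure: "sets (hausdorff_measure d) = sets borel"
  unfolding hausdorff_measure_def
  using sets.sigma_sets_eq[of "borel :: 'a measure"] by simp

lemma space_hausdorff_measure: "space (hausdorff_measure d) = UNIV"
  unfolding hausdorff_measure_def by (simp add: space_measure_of_conv)

section \<open>The relative isoperimetric inequality\<close>

text \<open>Walking from \<open>x\<close> to \<open>y\<close> by exchanging one coordinate at a time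
  must leave \<open>S\<close> at some step; otherwise induction over the exchanged coordinates would
  put \<open>y\<close> into \<open>S\<close>.\<close>

lemma exists_coordinate_switch:
  fixes x y :: "real^'n::finite"
  assumes "x \<in> S" "y \<notin> S"
  shows "\<exists>J j. j \<notin> J \<and> (\<chi> l. if l \<in> J then y $ l else x $ l) \<in> S \<and>
    (\<chi> l. if l \<in> insert j J then y $ l else x $ l) \<notin> S"
proof (rule ccontr)
  assume contra: "\<not> ?thesis"
  have "(\<chi> l. if l \<in> J then y $ l else x $ l) \<in> S" for J :: "'n set"
    using finite[of J]
  proof (induction J rule: finite_induct)
    case empty
    then show ?case using assms(1) by simp
  next
    case (insert j J)
    then show ?case using contra by blast
  qed
  from this[of UNIV] show False using assms(2) by simp
qed

text \<open>A box around the cylinder over \<open>C\<close> in direction \<open>j\<close>, cut off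
  at the faces of the cube from \<open>a\<close> to \<open>b\<close>. Sets of a Hausdorff cover are
  arbitrary, so the exact cylinder might not be measurable; the box is centred at some point of
  \<open>C\<close> with half-width \<open>diameter C\<close> and has an explicit volume.\<close>

definition cylinder_box :: "real^'n::finite \<Rightarrow> real^'n \<Rightarrow> 'n \<Rightarrow> (real^'n) set \<Rightarrow> (real^'n) set" where
  "cylinder_box a b j C = (if C = {} then {} else
     cbox (\<chi> l. if l = j then a $ l else (SOME z. z \<in> C) $ l - diameter C)
          (\<chi> l. if l = j then b $ l else (SOME z. z \<in> C) $ l + diameter C))"

lemma cylinder_box_borel [measurable]: "cylinder_box a b j C \<in> sets borel"
  by (simp add: cylinder_box_def)

lemma mem_cylinder_box:
  assumes "w \<in> C" "bounded C" "\<And>l. l \<noteq> j \<Longrightarrow> x $ l = w $ l" "a $ j \<le> x $ j" "x $ j \<le> b $ j"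
  shows "x \<in> cylinder_box a b j C"
proof -
  define z where "z = (SOME z. z \<in> C)"
  have "z \<in> C" unfolding z_def using assms(1) by (rule someI)
  then have "dist w z \<le> diameter C" using assms diameter_bounded_bound by blast
  then have "\<bar>w $ l - z $ l\<bar> \<le> diameter C" for l
    using component_le_norm_cart[of "w - z" l] by (simp add: dist_norm)
  then have "\<bar>x $ l - z $ l\<bar> \<le> diameter C" if "l \<noteq> j" for l
    using assms(3)[OF that] by simp
  then have "z $ l - diameter C \<le> x $ l \<and> x $ l \<le> z $ l + diameter C" if "l \<noteq> j" for l
    using that by (smt (verit))
  then show ?thesis
    using assms unfolding cylinder_box_def z_def[symmetric] by (auto simp: mem_box_cart)
qed

lemma emeasure_cylinder_box:
  fixes a b :: "real^'n::finite"
  assumes "a $ j \<le> b $ j" "bounded C"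
  shows "emeasure lborel (cylinder_box a b j C) \<le> ennreal ((b $ j - a $ j) * (2 * diameter C) ^ (CARD('n) - 1))"
proof (cases "C = {}")
  case False
  let ?f = "\<lambda>l. if l = j then b $ j - a $ j else 2 * diameter C"
  let ?p = "(\<chi> l. if l = j then a $ l else (SOME z. z \<in> C) $ l - diameter C) :: real^'n"
  let ?q = "(\<chi> l. if l = j then b $ l else (SOME z. z \<in> C) $ l + diameter C) :: real^'n"
  have "0 \<le> diameter C" using assms(2) by (rule diameter_ge_0)
  then have "?p \<in> cbox ?p ?q" using assms by (auto simp: mem_box_cart)
  then have "measure lborel (cbox ?p ?q) = (\<Prod>l\<in>UNIV. ?q $ l - ?p $ l)"
    using content_cbox_cart[of ?p ?q] by blast
  also have "\<dots> = (\<Prod>l\<in>UNIV. ?f l)"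
    by (intro prod.cong) auto
  also have "\<dots> = ?f j * (\<Prod>l\<in>UNIV - {j}. ?f l)"
    by (subst prod.remove[of _ j]) auto
  also have "(\<Prod>l\<in>UNIV - {j}. ?f l) = (\<Prod>l\<in>UNIV - {j}. 2 * diameter C)"
    by (intro prod.cong) auto
  also have "\<dots> = (2 * diameter C) ^ (CARD('n) - 1)"
    by (simp add: card_Diff_singleton)
  finally have "measure lborel (cbox ?p ?q) = (b $ j - a $ j) * (2 * diameter C) ^ (CARD('n) - 1)"
    by simp
  then show ?thesis
    using False emeasure_lborel_cbox_finite[of ?p ?q]
    by (simp add: cylinder_box_def emeasure_eq_ennreal_measure)
qed (simp add: cylinder_box_def)

section \<open>Translations and Lebesgue measure\<close>

lemma emeasure_lborel_translate:
  fixes A :: "'a::euclidean_space set"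
  assumes "A \<in> sets borel"
  shows "emeasure lborel {x. x + w \<in> A} = emeasure lborel A"
proof -
  have "emeasure (distr lborel borel ((+) w)) A = emeasure lborel ((+) w -` A \<inter> space lborel)"
    using assms by (intro emeasure_distr) auto
  then show ?thesis by (simp add: lborel_distr_plus vimage_def add.commute)
qed

text \<open>Tonelli for the set of pairs (x, v) with \<open>x \<in> E\<close> and
  \<open>x + v \<in> F\<close>: for fixed \<open>x\<close> the admissible \<open>v\<close> form a
  translate of \<open>F\<close>. The product of volumes thus becomes an average over displacements,
  each of which can be estimated separately.\<close>

lemma emeasure_lborel_mult_eq:
  fixes E F :: "'a::euclidean_space set"
  assumes [measurable]: "E \<in> sets borel" "F \<in> sets borel"
  shows "emeasure lborel E * emeasure lborel F = (\<integral>\<^sup>+v. emeasure lborel (E \<inter> {x. x + v \<in> F}) \<partial>lborel)"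
proof -
  have "(\<integral>\<^sup>+v. emeasure lborel (E \<inter> {x. x + v \<in> F}) \<partial>lborel) =
      (\<integral>\<^sup>+v. (\<integral>\<^sup>+x. indicator E x * indicator F (x + v) \<partial>lborel) \<partial>lborel)"
  proof (intro nn_integral_cong)
    fix v :: 'a
    have "(\<integral>\<^sup>+x. indicator E x * indicator F (x + v) \<partial>lborel) =
       (\<integral>\<^sup>+x. indicator (E \<inter> {x. x + v \<in> F}) x \<partial>lborel)"
      by (intro nn_integral_cong) (auto simp: indicator_def)
    also have "\<dots> = emeasure lborel (E \<inter> {x. x + v \<in> F})"
      by (rule nn_integral_indicator) measurable
    finally show "emeasure lborel (E \<inter> {x. x + v \<in> F}) = (\<integral>\<^sup>+x. indicator E x * indicator F (x + v) \<partial>lborel)" ..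
  qed
  also have "\<dots> = (\<integral>\<^sup>+x. (\<integral>\<^sup>+v. indicator E x * indicator F (x + v) \<partial>lborel) \<partial>lborel)"
    by (rule lborel_pair.Fubini') measurable
  also have "\<dots> = (\<integral>\<^sup>+x. indicator E x * emeasure lborel F \<partial>lborel)"
  proof (intro nn_integral_cong)
    fix x :: 'a
    have "(\<integral>\<^sup>+v. indicator E x * indicator F (x + v) \<partial>lborel) = (\<integral>\<^sup>+v. indicator E x * indicator {v. v + x \<in> F} v \<partial>lborel)"
      by (intro nn_integral_cong) (auto simp: indicator_def add.commute)
    also have "\<dots> = indicator E x * (\<integral>\<^sup>+v. indicator {v. v + x \<in> F} v \<partial>lborel)"
      by (rule nn_integral_cmult) measurable
    also have "(\<integral>\<^sup>+v. indicator {v. v + x \<in> F} v \<partial>lborel) = emeasure lborel {v. v + x \<in> F}"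
      by (rule nn_integral_indicator) measurable
    finally show "(\<integral>\<^sup>+v. indicator E x * indicator F (x + v) \<partial>lborel) = indicator E x * emeasure lborel F"
      by (simp add: emeasure_lborel_translate)
  qed
  also have "\<dots> = emeasure lborel E * emeasure lborel F"
    by (simp add: nn_integral_multc)
  finally show ?thesis ..
qed

text \<open>A path from \<open>x \<in> E\<close> to \<open>x + v \<in> F\<close> that changes one coordinate at a time must cross the frontier,
  so for each \<open>v\<close> the set of such \<open>x\<close> is covered by translated cylinders over any cover of the
  frontier.\<close>

lemma relative_isoperimetric_cover:
  fixes a b :: "real^'n::finite" and S :: "(real^'n) set" and C :: "nat \<Rightarrow> (real^'n) set" and l :: real
  assumes l: "l > 0" "\<And>i. b $ i = a $ i + l"
    and EF: "E \<subseteq> cbox a b \<inter> S" "F \<subseteq> cbox a b - S" "E \<in> sets borel" "F \<in> sets borel"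
    and C: "frontier S \<inter> cbox a b \<subseteq> (\<Union>i. C i)" "\<And>i. bounded (C i)"
  shows "emeasure lborel E * emeasure lborel F \<le>
    ennreal (4 ^ CARD('n) * CARD('n) * l ^ (CARD('n) + 1)) * (\<Sum>i. ennreal ((2 * diameter (C i)) ^ (CARD('n) - 1)))"
proof -
  let ?n = "CARD('n)"
  let ?s = "\<Sum>i. ennreal ((2 * diameter (C i)) ^ (?n - 1))"
  define V where "V = (cbox (\<chi> i. - l) (\<chi> i. l) :: (real^'n) set)"
  define T where "T v J j i = {x. x + (\<chi> k. if k \<in> J then v $ k else 0) \<in> cylinder_box a b j (C i)}" for v J j i
  have slice: "emeasure lborel (E \<inter> {x. x + v \<in> F}) \<le> ennreal (2 ^ ?n * ?n * l) * ?s * indicator V v" for v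
  proof (cases "v \<in> V")
    case False
    have "E \<inter> {x. x + v \<in> F} = {}"
    proof (rule ccontr)
      assume "\<not> ?thesis"
      then obtain x where "x \<in> cbox a b" "x + v \<in> cbox a b" using EF by blast
      then have "a $ i \<le> x $ i \<and> x $ i \<le> a $ i + l" "a $ i \<le> x $ i + v $ i \<and> x $ i + v $ i \<le> a $ i + l" for i
        using l by (auto simp: mem_box_cart)
      then have "- l \<le> v $ i \<and> v $ i \<le> l" for i by (smt (verit))
      then show False using False by (auto simp: V_def mem_box_cart)
    qed
    then show ?thesis by simp
  next
    case True
    have "E \<inter> {x. x + v \<in> F} \<subseteq> (\<Union>J\<in>UNIV. \<Union>j\<in>UNIV. \<Union>i. T v J j i)"
    proof
      fix x assume x: "x \<in> E \<inter> {x. x + v \<in> F}"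
      define m where "m J = (\<chi> k. if k \<in> J then (x + v) $ k else x $ k)" for J
      have xb: "x \<in> cbox a b" "x + v \<in> cbox a b" and "x \<in> S" "x + v \<notin> S" using x EF by auto
      then obtain J j where J: "j \<notin> J" "m J \<in> S" "m (insert j J) \<notin> S"
        using exists_coordinate_switch[of x S "x + v"] unfolding m_def by blast
      have mb: "m K \<in> cbox a b" for K
        using xb by (auto simp: m_def mem_box_cart)
      have "closed_segment (m J) (m (insert j J)) \<inter> frontier S \<noteq> {}"
        by (rule connected_Int_frontier) (use J in auto)
      then obtain w where w: "w \<in> closed_segment (m J) (m (insert j J))" "w \<in> frontier S" by blast
      then have "w \<in> cbox a b"
        using closed_segment_subset[OF mb mb convex_box(1)] by blast
      then obtain i where i: "w \<in> C i" using C w by blast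
      obtain t where t: "w = (1 - t) *\<^sub>R m J + t *\<^sub>R m (insert j J)"
        using w by (auto simp: in_segment)
      \<comment> \<open>The segment is parallel to the \<open>j\<close> axis, so \<open>m J\<close>
        lies in the cylinder through the crossing point \<open>w\<close>. For fixed \<open>v\<close>
        and \<open>J\<close>, \<open>m J\<close> is a fixed translate of \<open>x\<close>, which
        confines \<open>x\<close> to a translate of one box.\<close>
      have "m J $ k = w $ k" if "k \<noteq> j" for k
        using that unfolding t by (simp add: m_def algebra_simps)
      then have "m J \<in> cylinder_box a b j (C i)"
        using mb[of J] by (intro mem_cylinder_box[OF i C(2)]) (auto simp: mem_box_cart)
      moreover have "m J = x + (\<chi> k. if k \<in> J then v $ k else 0)"
        by (simp add: m_def vec_eq_iff)
      ultimately show "x \<in> (\<Union>J\<in>UNIV. \<Union>j\<in>UNIV. \<Union>i. T v J j i)"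
        by (auto simp: T_def)
    qed
    moreover have [measurable]: "T v J j i \<in> sets borel" for J j i
      unfolding T_def by measurable
    ultimately have "emeasure lborel (E \<inter> {x. x + v \<in> F}) \<le> emeasure lborel (\<Union>J\<in>UNIV. \<Union>j\<in>UNIV. \<Union>i. T v J j i)"
      by (intro emeasure_mono) auto
    also have "\<dots> \<le> (\<Sum>J\<in>UNIV. emeasure lborel (\<Union>j\<in>UNIV. \<Union>i. T v J j i))"
      by (intro emeasure_subadditive_finite) auto
    also have "\<dots> \<le> (\<Sum>J\<in>(UNIV :: 'n set set). \<Sum>j\<in>(UNIV :: 'n set). emeasure lborel (\<Union>i. T v J j i))"
      by (intro sum_mono emeasure_subadditive_finite) auto
    also have "\<dots> \<le> (\<Sum>J\<in>(UNIV :: 'n set set). \<Sum>j\<in>(UNIV :: 'n set). ennreal l * ?s)"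
    proof (intro sum_mono)
      fix J :: "'n set" and j :: 'n
      have "emeasure lborel (\<Union>i. T v J j i) \<le> (\<Sum>i. emeasure lborel (T v J j i))"
        by (intro emeasure_subadditive_countably) auto
      also have "\<dots> \<le> (\<Sum>i. ennreal l * ennreal ((2 * diameter (C i)) ^ (?n - 1)))"
      proof (intro suminf_le allI)
        fix i
        have "emeasure lborel (T v J j i) = emeasure lborel (cylinder_box a b j (C i))"
          unfolding T_def by (intro emeasure_lborel_translate cylinder_box_borel)
        also have "\<dots> \<le> ennreal ((b $ j - a $ j) * (2 * diameter (C i)) ^ (CARD('n) - 1))"
          using l C by (intro emeasure_cylinder_box) auto
        finally show "emeasure lborel (T v J j i) \<le> ennreal l * ennreal ((2 * diameter (C i)) ^ (?n - 1))"
          using l C by (simp add: ennreal_mult diameter_ge_0)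
      qed auto
      finally show "emeasure lborel (\<Union>i. T v J j i) \<le> ennreal l * ?s"
        by simp
    qed
    also have "\<dots> = ennreal (2 ^ ?n * ?n * l) * ?s"
      using l by (simp add: card_UNIV_set ennreal_mult ennreal_of_nat_eq_real_of_nat[symmetric] mult.assoc
         flip: ennreal_power)
    finally show ?thesis using True by simp
  qed
  have V: "emeasure lborel V = ennreal ((2 * l) ^ ?n)"
  proof -
    have "0 \<in> V" using l by (simp add: V_def mem_box_cart)
    then have "measure lborel V = (2 * l) ^ ?n"
      unfolding V_def using content_cbox_cart[of "\<chi> i. - l" "\<chi> i::'n. l"] by fastforce
    then show ?thesis
      using emeasure_lborel_cbox_finite by (metis V_def emeasure_eq_ennreal_measure infinity_ennreal_def less_irrefl)
  qed
  have "emeasure lborel E * emeasure lborel F = (\<integral>\<^sup>+v. emeasure lborel (E \<inter> {x. x + v \<in> F}) \<partial>lborel)"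
    by (rule emeasure_lborel_mult_eq) fact+
  also have "\<dots> \<le> (\<integral>\<^sup>+v. ennreal (2 ^ ?n * ?n * l) * ?s * indicator V v \<partial>lborel)"
    by (intro nn_integral_mono slice)
  also have "\<dots> = ennreal (2 ^ ?n * ?n * l) * ?s * emeasure lborel V"
    by (subst nn_integral_cmult_indicator) (auto simp: V_def)
  also have "\<dots> = (ennreal (2 ^ ?n * ?n * l) * ennreal ((2 * l) ^ ?n)) * ?s"
    unfolding V by (simp add: mult_ac)
  \<comment> \<open>There are 2 ^ n sets \<open>J\<close> and n directions \<open>j\<close>, each
    contributing a box of height \<open>l\<close>; the displacements fill a cube of volume (2 * l) ^
    n.\<close>
  also have "ennreal (2 ^ ?n * ?n * l) * ennreal ((2 * l) ^ ?n) = ennreal (4 ^ ?n * ?n * l ^ (?n + 1))"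
  proof -
    have "(4::real) ^ ?n = 2 ^ ?n * 2 ^ ?n"
      using power_mult_distrib[of "2::real" 2 ?n] by simp
    then have "(2 ^ ?n * ?n * l) * (2 * l) ^ ?n = 4 ^ ?n * ?n * l ^ (?n + 1)"
      by (simp add: power_mult_distrib)
    then show ?thesis
      using l by (simp add: ennreal_mult'[symmetric])
  qed
  finally show ?thesis .
qed

text \<open>The covering estimate holds for sets of every diameter, so already the premeasure at
  scale 1 is bounded below. \<open>E\<close> and \<open>F\<close> may be proper parts of the two
  sides, since they will be taken from two small cubes inside a larger one. The factor 4 ^ (n - 1) /
  \<open>om\<close> converts (2 * diameter) ^ (n - 1) to the normalised Hausdorff weight.\<close>

lemma relative_isoperimetric:
  assumes n: "CARD('n::finite) \<ge> 2"
  shows "\<exists>K>0. \<forall>(a::real^'n) b S l E F. l > 0 \<longrightarrow> (\<forall>i. b $ i = a $ i + l) \<longrightarrow>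
     E \<subseteq> cbox a b \<inter> S \<longrightarrow> F \<subseteq> cbox a b - S \<longrightarrow> E \<in> sets borel \<longrightarrow> F \<in> sets borel \<longrightarrow>
     emeasure lborel E * emeasure lborel F \<le>
       ennreal (K * l ^ (CARD('n) + 1)) * hausdorff_outer (CARD('n) - 1) (frontier S \<inter> cbox a b)"
proof -
  let ?n = "CARD('n)"
  define om where "om = unit_ball_vol (real (?n - 1))"
  have om: "om > 0" by (simp add: om_def)
  define K where "K = 4 ^ ?n * ?n * (4 ^ (?n - 1) / om)"
  have K: "K > 0" using om by (simp add: K_def)
  show ?thesis
  proof (intro exI[of _ K] conjI K allI impI)
    fix a b :: "real^'n" and S l E F
    assume A: "l > 0" "\<forall>i. b $ i = a $ i + l" "E \<subseteq> cbox a b \<inter> S" "F \<subseteq> cbox a b - S"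
      "E \<in> sets borel" "F \<in> sets borel"
    let ?A = "frontier S \<inter> cbox a b"
    let ?X = "emeasure lborel E * emeasure lborel F"
    define k where "k = K * l ^ (?n + 1)"
    have k: "k > 0" using K A by (simp add: k_def)
    then have ennreal_inv: "ennreal (1 / k) * ennreal k = 1"
      by (subst ennreal_mult''[symmetric]) auto
    \<comment> \<open>With the constant moved to the left, the claim is a lower bound for an infimum
      and can be checked cover by cover.\<close>
    have "ennreal (1 / k) * ?X \<le> hausdorff_premeasure (?n - 1) 1 ?A"
      unfolding hausdorff_premeasure_def
    proof (rule INF_greatest, clarify)
      fix C :: "nat \<Rightarrow> (real^'n) set"
      assume C: "?A \<subseteq> (\<Union>i. C i)" "\<forall>i. bounded (C i) \<and> diameter (C i) \<le> 1"
      let ?s = "\<Sum>i. ennreal (unit_ball_vol (real (?n - 1)) * (diameter (C i) / 2) ^ (?n - 1))"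
      have "?X \<le> ennreal (4 ^ ?n * ?n * l ^ (?n + 1)) * (\<Sum>i. ennreal ((2 * diameter (C i)) ^ (?n - 1)))"
        using A C by (intro relative_isoperimetric_cover) auto
      also have "(\<Sum>i. ennreal ((2 * diameter (C i)) ^ (?n - 1))) =
         (\<Sum>i. ennreal (4 ^ (?n - 1) / om) * ennreal (om * (diameter (C i) / 2) ^ (?n - 1)))"
      proof (intro suminf_cong)
        fix i
        have "0 \<le> diameter (C i)" using C diameter_ge_0 by blast
        have "(4 ^ (?n - 1) / om) * (om * (diameter (C i) / 2) ^ (?n - 1)) = 4 ^ (?n - 1) * (diameter (C i) / 2) ^ (?n - 1)"
          using om by simp
        also have "\<dots> = (4 * (diameter (C i) / 2)) ^ (?n - 1)"
          by (rule power_mult_distrib[symmetric])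
        finally show "ennreal ((2 * diameter (C i)) ^ (?n - 1)) = ennreal (4 ^ (?n - 1) / om) * ennreal (om * (diameter (C i) / 2) ^ (?n - 1))"
          using om \<open>0 \<le> diameter (C i)\<close> by (simp flip: ennreal_mult)
      qed
      also have "\<dots> = ennreal (4 ^ (?n - 1) / om) * ?s" by (simp add: om_def)
      also have "ennreal (4 ^ ?n * ?n * l ^ (?n + 1)) * \<dots> = ennreal k * ?s"
      proof -
        have "(4 ^ ?n * ?n * l ^ (?n + 1)) * (4 ^ (?n - 1) / om) = k"
          by (simp add: k_def K_def)
        moreover have "0 \<le> 4 ^ (?n - 1) / om" using om by simp
        ultimately have "ennreal (4 ^ ?n * ?n * l ^ (?n + 1)) * ennreal (4 ^ (?n - 1) / om) = ennreal k"
          by (subst ennreal_mult''[symmetric]) auto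
        then show ?thesis by (simp only: mult.assoc[symmetric])
      qed
      finally have "ennreal (1 / k) * ?X \<le> ennreal (1 / k) * (ennreal k * ?s)"
        by (intro mult_left_mono) auto
      also have "\<dots> = ?s"
        using ennreal_inv by (simp only: mult.assoc[symmetric] mult_1_left)
      finally show "ennreal (1 / k) * ?X \<le> ?s" .
    qed
    also have "\<dots> \<le> hausdorff_outer (?n - 1) ?A" by (rule hausdorff_premeasure_le_outer) simp
    finally have "ennreal k * (ennreal (1 / k) * ?X) \<le> ennreal k * hausdorff_outer (?n - 1) ?A"
      by (intro mult_left_mono) auto
    then show "?X \<le> ennreal (K * l ^ (?n + 1)) * hausdorff_outer (?n - 1) ?A"
      unfolding k_def[symmetric] using ennreal_inv
      by (simp only: mult.assoc[symmetric] mult_1_left mult.commute[of "ennreal k" "ennreal (1 / k)"])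
  qed
qed

section \<open>The grid and the discrete isoperimetric inequality\<close>

lemma card_int_box:
  shows "finite {v :: int^'n::finite. \<forall>i. a \<le> v $ i \<and> v $ i < a + int m}" (is "finite ?V")
    and "card {v :: int^'n. \<forall>i. a \<le> v $ i \<and> v $ i < a + int m} = m ^ CARD('n)"
proof -
  let ?P = "PiE (UNIV :: 'n set) (\<lambda>_. {a..<a + int m})"
  have bij: "bij_betw vec_lambda ?P ?V"
    by (rule bij_betwI[where g = vec_nth]) (auto simp: PiE_iff)
  have "finite ?P" by (intro finite_PiE) auto
  then show "finite ?V" using bij_betw_finite[OF bij] by blast
  show "card ?V = m ^ CARD('n)"
    using bij_betw_same_card[OF bij] by (simp add: card_PiE)
qed

text \<open>For the unit vector of an axis this counts the faces of \<open>D\<close> on one side, so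
  the sum over all axes is a one-sided discrete perimeter.\<close>

definition exit_count :: "(int^'n::finite) set \<Rightarrow> int^'n \<Rightarrow> nat" where
  "exit_count D v = card {p \<in> D. p + v \<notin> D}"

text \<open>A point that leaves under \<open>v + w\<close> leaves under \<open>v\<close>, or else
  its image under \<open>v\<close> is still in \<open>D\<close> and leaves under \<open>w\<close>;
  translation by \<open>v\<close> is injective.\<close>

lemma exit_count_add:
  assumes "finite D"
  shows "exit_count D (v + w) \<le> exit_count D v + exit_count D w"
proof -
  let ?B = "{p \<in> D. p + v \<in> D \<and> (p + v) + w \<notin> D}"
  have "exit_count D (v + w) \<le> card ({p \<in> D. p + v \<notin> D} \<union> ?B)"
    unfolding exit_count_def using assms by (intro card_mono) (auto simp: add.assoc)
  also have "\<dots> \<le> card {p \<in> D. p + v \<notin> D} + card ?B"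
    by (rule card_Un_le)
  also have "card ?B \<le> card {p \<in> D. p + w \<notin> D}"
    using assms by (intro card_inj_on_le[where f = "\<lambda>p. p + v"]) (auto simp: inj_on_def)
  finally show ?thesis by (simp add: exit_count_def)
qed

lemma exit_count_axis:
  assumes "finite D"
  shows "exit_count D (axis i (int k)) \<le> k * exit_count D (axis i 1)"
proof (induction k)
  case 0
  then show ?case by (simp add: exit_count_def axis_def zero_vec_def[symmetric])
next
  case (Suc k)
  have "axis i (int (Suc k)) = axis i (int k) + axis i (1 :: int)"
    by (simp add: vec_eq_iff axis_def)
  then show ?case
    using exit_count_add[OF assms, of "axis i (int k)" "axis i 1"] Suc by simp
qed

lemma exit_count_le:
  fixes v :: "int^'n::finite"
  assumes "finite D" "\<And>i. 0 \<le> v $ i \<and> v $ i < int L"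
  shows "exit_count D v \<le> L * (\<Sum>i\<in>UNIV. exit_count D (axis i 1))"
proof -
  have "exit_count D (\<Sum>i\<in>J. axis i (v $ i)) \<le> (\<Sum>i\<in>J. L * exit_count D (axis i 1))" for J :: "'n set"
    using finite[of J]
  proof (induction J rule: finite_induct)
    case empty
    then show ?case by (simp add: exit_count_def)
  next
    case (insert i J)
    have "exit_count D (axis i (v $ i)) \<le> nat (v $ i) * exit_count D (axis i 1)"
      using exit_count_axis[OF assms(1), of i "nat (v $ i)"] assms(2)[of i] by simp
    also have "\<dots> \<le> L * exit_count D (axis i 1)"
      using assms(2)[of i] by (intro mult_right_mono) auto
    finally show ?case
      using insert exit_count_add[OF assms(1), of "axis i (v $ i)" "\<Sum>i\<in>J. axis i (v $ i)"] by simp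
  qed
  moreover have "(\<Sum>i\<in>UNIV. axis i (v $ i)) = v"
    by (simp add: vec_eq_iff axis_def sum.delta)
  ultimately show ?thesis by (metis sum_distrib_left)
qed

text \<open>Averaging over displacements, the discrete analogue of the volume identity above: each
  pair of points of \<open>D\<close> is joined by one displacement, so among L ^ n >= 2 * card D of
  them some \<open>v\<close> keeps at most half of \<open>D\<close> inside. The other half exits,
  and \<open>v\<close> decomposes into fewer than \<open>L\<close> unit steps along each
  axis.\<close>

lemma discrete_isoperimetric:
  fixes D :: "(int^'n::finite) set"
  assumes D: "finite D" and L: "2 * card D \<le> L ^ CARD('n)"
  shows "card D \<le> 2 * L * (\<Sum>i\<in>UNIV. exit_count D (axis i 1))"
proof (cases "D = {}")
  case False
  then have m: "card D > 0" using D by auto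
  define V where "V = {v :: int^'n. \<forall>i. 0 \<le> v $ i \<and> v $ i < int L}"
  have V: "finite V" "card V = L ^ CARD('n)"
    using card_int_box[where a = 0 and m = L and 'n = 'n] by (auto simp: V_def)
  have "(\<Sum>v\<in>V. card {p \<in> D. p + v \<in> D}) = card (Sigma V (\<lambda>v. {p \<in> D. p + v \<in> D}))"
    using V D by simp
  also have "\<dots> \<le> card (D \<times> D)"
    using D by (intro card_inj_on_le[where f = "\<lambda>(v, p). (p, p + v)"]) (auto simp: inj_on_def)
  finally have sum_le: "(\<Sum>v\<in>V. card {p \<in> D. p + v \<in> D}) \<le> card D * card D"
    by (simp add: card_cartesian_product)
  have "\<exists>v\<in>V. 2 * card {p \<in> D. p + v \<in> D} \<le> card D"
  proof (rule ccontr)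
    assume "\<not> ?thesis"
    then have "\<And>v. v \<in> V \<Longrightarrow> card D < 2 * card {p \<in> D. p + v \<in> D}" by auto
    moreover have "card V > 0" using V(2) L m by linarith
    then have "V \<noteq> {}" by auto
    ultimately have "(\<Sum>v\<in>V. card D) < (\<Sum>v\<in>V. 2 * card {p \<in> D. p + v \<in> D})"
      using V by (intro sum_strict_mono) auto
    also have "\<dots> = 2 * (\<Sum>v\<in>V. card {p \<in> D. p + v \<in> D})" by (simp add: sum_distrib_left)
    also have "\<dots> \<le> 2 * (card D * card D)" using sum_le by simp
    also have "\<dots> \<le> L ^ CARD('n) * card D" using L by simp
    finally show False using V by simp
  qed
  then obtain v where v: "v \<in> V" "2 * card {p \<in> D. p + v \<in> D} \<le> card D" by blast
  have "card D = card ({p \<in> D. p + v \<in> D} \<union> {p \<in> D. p + v \<notin> D})"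
    by (rule arg_cong[of _ _ card]) auto
  also have "\<dots> \<le> card {p \<in> D. p + v \<in> D} + exit_count D v"
    unfolding exit_count_def by (rule card_Un_le)
  finally have "card D \<le> card {p \<in> D. p + v \<in> D} + exit_count D v" .
  then have "card D \<le> 2 * exit_count D v" using v by linarith
  also have "exit_count D v \<le> L * (\<Sum>i\<in>UNIV. exit_count D (axis i 1))"
    using v D by (intro exit_count_le) (auto simp: V_def)
  finally show ?thesis by simp
qed simp

text \<open>Pigeonhole on the residues modulo 5 of all coordinates: distinct points in the same
  class differ by a nonzero multiple of 5 in some coordinate.\<close>

lemma exists_separated_subset:
  fixes A :: "(int^'n::finite) set"
  assumes "finite A" "5 ^ CARD('n) * k \<le> card A" "k \<ge> 1"
  shows "\<exists>B\<subseteq>A. card B = k \<and> (\<forall>p\<in>B. \<forall>q\<in>B. p \<noteq> q \<longrightarrow> (\<exists>i. \<bar>p $ i - q $ i\<bar> \<ge> 5))"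
proof -
  define r where "r p = (\<chi> i. p $ i mod 5)" for p :: "int^'n"
  define Y where "Y = {v :: int^'n. \<forall>i. 0 \<le> v $ i \<and> v $ i < 0 + int 5}"
  have Y: "finite Y" "card Y = 5 ^ CARD('n)"
    unfolding Y_def by (rule card_int_box)+
  have rY: "r p \<in> Y" for p by (simp add: r_def Y_def)
  have "\<exists>y\<in>Y. k \<le> card {p \<in> A. r p = y}"
  proof (rule ccontr)
    assume "\<not> ?thesis"
    then have *: "card {p \<in> A. r p = y} < k" if "y \<in> Y" for y using that by force
    have "card A = (\<Sum>y\<in>Y. card {p \<in> A. r p = y})"
      using sum.group[of A Y r "\<lambda>_. 1::nat"] assms(1) Y rY by (simp add: image_subset_iff)
    also have "\<dots> < (\<Sum>y\<in>Y. k)"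
      using Y * rY by (intro sum_strict_mono) auto
    finally show False using Y assms by simp
  qed
  then obtain y where "k \<le> card {p \<in> A. r p = y}" by blast
  then obtain B where B: "B \<subseteq> {p \<in> A. r p = y}" "card B = k"
    by (meson obtain_subset_with_card_n)
  have "\<exists>i. \<bar>p $ i - q $ i\<bar> \<ge> 5" if "p \<in> B" "q \<in> B" "p \<noteq> q" for p q
  proof -
    obtain i where i: "p $ i \<noteq> q $ i" using \<open>p \<noteq> q\<close> by (auto simp: vec_eq_iff)
    have "r p = r q" using that B by auto
    then have "p $ i mod 5 = q $ i mod 5" by (simp add: r_def vec_eq_iff)
    then have "\<bar>p $ i - q $ i\<bar> \<ge> 5" using i by presburger
    then show ?thesis ..
  qed
  then show ?thesis using B by blast
qed

section \<open>Geometry of the cubes Q, the blocks 5Q and the cores 3Q of the grid\<close>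

definition grid_cube :: "real \<Rightarrow> int^'n::finite \<Rightarrow> (real^'n) set" where
  "grid_cube R p = {x. \<forall>i. R * p $ i \<le> x $ i \<and> x $ i < R * (p $ i + 1)}"

definition grid_block :: "real \<Rightarrow> int^'n::finite \<Rightarrow> (real^'n) set" where
  "grid_block R p = {x. \<forall>i. R * (p $ i - 2) \<le> x $ i \<and> x $ i < R * (p $ i + 3)}"

text \<open>Closed, because isoperimetry is stated for \<open>cbox\<close>; cubes and blocks are
  half-open, so that cubes tile the space and blocks five steps apart are disjoint.\<close>

definition grid_core :: "real \<Rightarrow> int^'n::finite \<Rightarrow> (real^'n) set" where
  "grid_core R p = cbox (\<chi> i. R * (p $ i - 1)) (\<chi> i. R * (p $ i + 2))"

lemma grid_cube_borel [measurable]: "grid_cube R p \<in> sets borel"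
  unfolding grid_cube_def by measurable

lemma grid_block_borel [measurable]: "grid_block R p \<in> sets borel"
  unfolding grid_block_def by measurable

lemma mem_grid_cube_iff:
  assumes "R > 0"
  shows "x \<in> grid_cube R p \<longleftrightarrow> p = (\<chi> i. \<lfloor>x $ i / R\<rfloor>)"
proof -
  have "R * p $ i \<le> x $ i \<and> x $ i < R * (p $ i + 1) \<longleftrightarrow> p $ i = \<lfloor>x $ i / R\<rfloor>" for i
  proof -
    have "p $ i = \<lfloor>x $ i / R\<rfloor> \<longleftrightarrow> real_of_int (p $ i) \<le> x $ i / R \<and> x $ i / R < real_of_int (p $ i) + 1"
      by (metis floor_eq_iff)
    then show ?thesis using assms by (simp add: field_simps)
  qed
  then show ?thesis by (simp add: grid_cube_def vec_eq_iff)
qed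

lemma grid_cube_disjoint: "R > 0 \<Longrightarrow> p \<noteq> q \<Longrightarrow> grid_cube R p \<inter> grid_cube R q = {}"
  by (auto simp: mem_grid_cube_iff)

lemma grid_block_subset:
  fixes p :: "int^'n::finite"
  assumes "R > 0"
  shows "grid_block R p \<subseteq> (\<Union>v\<in>{v. \<forall>i. -2 \<le> v $ i \<and> v $ i < -2 + int 5}. grid_cube R (p + v))"
proof
  fix x assume x: "x \<in> grid_block R p"
  define q where "q = (\<chi> i. \<lfloor>x $ i / R\<rfloor>)"
  have "-2 \<le> (q - p) $ i \<and> (q - p) $ i < -2 + int 5" for i
  proof -
    have "real_of_int (p $ i - 2) \<le> x $ i / R" "x $ i / R < real_of_int (p $ i + 3)"
      using x assms by (auto simp: grid_block_def field_simps)
    then have "p $ i - 2 \<le> q $ i" "q $ i < p $ i + 3"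
      by (simp_all only: q_def vec_lambda_beta le_floor_iff floor_less_iff)
    then show ?thesis by simp
  qed
  moreover have "x \<in> grid_cube R (p + (q - p))"
    by (simp add: mem_grid_cube_iff[OF assms] q_def)
  ultimately show "x \<in> (\<Union>v\<in>{v. \<forall>i. -2 \<le> v $ i \<and> v $ i < -2 + int 5}. grid_cube R (p + v))"
    by blast
qed

lemma grid_block_disjoint:
  assumes R: "R > 0" and sep: "\<bar>p $ i - q $ i\<bar> \<ge> 5"
  shows "grid_block R p \<inter> grid_block R q = {}"
proof (rule ccontr)
  assume "\<not> ?thesis"
  then obtain x where "x \<in> grid_block R p" "x \<in> grid_block R q" by blast
  then have "R * (p $ i - 2) < R * (q $ i + 3)" "R * (q $ i - 2) < R * (p $ i + 3)"
    unfolding grid_block_def by (blast intro: le_less_trans)+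
  then have "real_of_int (p $ i - 2) < real_of_int (q $ i + 3)" "real_of_int (q $ i - 2) < real_of_int (p $ i + 3)"
    using R by simp_all
  then have "p $ i - 2 < q $ i + 3" "q $ i - 2 < p $ i + 3" by linarith+
  then show False using sep by linarith
qed

lemma grid_cube_subset_core: "R > 0 \<Longrightarrow> grid_cube R p \<subseteq> grid_core R p"
proof
  fix x assume R: "R > 0" and x: "x \<in> grid_cube R p"
  have "R * (p $ i - 1) \<le> x $ i \<and> x $ i \<le> R * (p $ i + 2)" for i
  proof -
    have "R * p $ i \<le> x $ i" "x $ i < R * (p $ i + 1)"
      using x by (auto simp: grid_cube_def)
    then show ?thesis using R by (simp add: algebra_simps)
  qed
  then show "x \<in> grid_core R p" by (simp add: grid_core_def mem_box_cart)
qed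

lemma grid_cube_shift_subset_core: "R > 0 \<Longrightarrow> grid_cube R (p + axis j 1) \<subseteq> grid_core R p"
proof
  fix x assume R: "R > 0" and x: "x \<in> grid_cube R (p + axis j 1)"
  have "R * (p $ i - 1) \<le> x $ i \<and> x $ i \<le> R * (p $ i + 2)" for i
  proof -
    have "R * (p + axis j 1) $ i \<le> x $ i" "x $ i < R * ((p + axis j 1) $ i + 1)"
      using x by (auto simp: grid_cube_def)
    then show ?thesis
      using R by (cases "i = j") (auto simp: axis_def algebra_simps)
  qed
  then show "x \<in> grid_core R p" by (simp add: grid_core_def mem_box_cart)
qed

lemma emeasure_grid_cube:
  fixes p :: "int^'n::finite"
  assumes "R > 0"
  shows "emeasure lborel (grid_cube R p) = ennreal (R ^ CARD('n))"
proof -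
  let ?a = "(\<chi> i. R * p $ i) :: real^'n" and ?b = "(\<chi> i. R * (p $ i + 1)) :: real^'n"
  have "?a \<in> cbox ?a ?b" using assms by (simp add: mem_box_cart)
  then have "measure lborel (cbox ?a ?b) = (\<Prod>i\<in>UNIV. ?b $ i - ?a $ i)"
    using content_cbox_cart[of ?a ?b] by blast
  also have "\<dots> = R ^ CARD('n)" by (simp add: algebra_simps)
  finally have c: "emeasure lborel (cbox ?a ?b) = ennreal (R ^ CARD('n))"
    using emeasure_lborel_cbox_finite[of ?a ?b] by (simp add: emeasure_eq_ennreal_measure)
  have "emeasure lborel (box ?a ?b) = emeasure lborel (cbox ?a ?b)"
    by (simp add: emeasure_lborel_box_eq emeasure_lborel_cbox_eq)
  moreover have "emeasure lborel (box ?a ?b) \<le> emeasure lborel (grid_cube R p)"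
    by (intro emeasure_mono) (auto simp: grid_cube_def mem_box_cart less_imp_le)
  moreover have "emeasure lborel (grid_cube R p) \<le> emeasure lborel (cbox ?a ?b)"
    by (intro emeasure_mono) (auto simp: grid_cube_def mem_box_cart less_imp_le)
  ultimately show ?thesis using c by simp
qed

section \<open>Active cubes\<close>

lemma sum_measure_grid_cube_le:
  fixes \<Omega> :: "(real^'n::finite) set"
  assumes \<Omega>: "open \<Omega>" "bounded \<Omega>" and R: "R > 0" and T: "finite T"
  shows "(\<Sum>p\<in>T. measure lborel (\<Omega> \<inter> grid_cube R p)) \<le> measure lborel \<Omega>"
proof -
  have fm: "\<Omega> \<in> fmeasurable lborel"
    using \<Omega> emeasure_bounded_finite by (auto intro!: fmeasurableI)
  have "(\<Sum>p\<in>T. measure lborel (\<Omega> \<inter> grid_cube R p)) = measure lborel (\<Union>p\<in>T. \<Omega> \<inter> grid_cube R p)"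
  proof (rule measure_UNION'[symmetric, OF T])
    show "\<Omega> \<inter> grid_cube R p \<in> fmeasurable lborel" for p
      using fm by (intro fmeasurable_Int_fmeasurable) auto
    show "pairwise (\<lambda>p q. disjnt (\<Omega> \<inter> grid_cube R p) (\<Omega> \<inter> grid_cube R q)) T"
      using grid_cube_disjoint[OF R] by (fastforce simp: pairwise_def disjnt_def)
  qed
  also have "\<dots> \<le> measure lborel \<Omega>"
    using fm T \<Omega> by (intro measure_mono_fmeasurable) auto
  finally show ?thesis .
qed

lemma measure_eq_sum_grid_cube:
  fixes \<Omega> :: "(real^'n::finite) set"
  assumes \<Omega>: "open \<Omega>" "bounded \<Omega>" and R: "R > 0"
  shows "\<exists>I. finite I \<and> (\<forall>p. p \<notin> I \<longrightarrow> \<Omega> \<inter> grid_cube R p = {}) \<and>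
    measure lborel \<Omega> \<le> (\<Sum>p\<in>I. measure lborel (\<Omega> \<inter> grid_cube R p))"
proof -
  obtain b where b: "\<And>x. x \<in> \<Omega> \<Longrightarrow> norm x \<le> b"
    using \<Omega>(2) by (auto simp: bounded_iff)
  define m where "m = nat \<lceil>\<bar>b\<bar> / R\<rceil> + 1"
  define I where "I = {v :: int^'n. \<forall>i. - int m \<le> v $ i \<and> v $ i < - int m + int (2 * m + 1)}"
  have I: "finite I" unfolding I_def by (rule card_int_box)
  have mb: "\<bar>b\<bar> / R \<le> real m" unfolding m_def by linarith
  have idx: "p \<in> I" if "x \<in> \<Omega>" "x \<in> grid_cube R p" for x and p :: "int^'n"
  proof -
    have "p $ i = \<lfloor>x $ i / R\<rfloor>" for i
      using that(2) by (simp add: mem_grid_cube_iff[OF R])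
    moreover have "\<bar>x $ i / R\<bar> \<le> real m" for i
    proof -
      have "\<bar>x $ i\<bar> \<le> \<bar>b\<bar>" using b[OF that(1)] component_le_norm_cart[of x i] by linarith
      then have "\<bar>x $ i / R\<bar> \<le> \<bar>b\<bar> / R" using R by (simp add: abs_divide divide_right_mono)
      then show ?thesis using mb by linarith
    qed
    ultimately have "- int m \<le> p $ i \<and> p $ i < - int m + int (2 * m + 1)" for i
    proof -
      have "- real m \<le> x $ i / R" "x $ i / R \<le> real m"
        using \<open>\<bar>x $ i / R\<bar> \<le> real m\<close> by linarith+
      then have "- int m \<le> \<lfloor>x $ i / R\<rfloor>" "\<lfloor>x $ i / R\<rfloor> \<le> int m" by linarith+
      then show ?thesis using \<open>p $ i = \<lfloor>x $ i / R\<rfloor>\<close> by simp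
    qed
    then show ?thesis by (simp add: I_def)
  qed
  have "\<Omega> \<subseteq> (\<Union>p\<in>I. \<Omega> \<inter> grid_cube R p)"
  proof
    fix x assume x: "x \<in> \<Omega>"
    then have "x \<in> grid_cube R (\<chi> i. \<lfloor>x $ i / R\<rfloor>)" by (simp add: mem_grid_cube_iff[OF R])
    with idx x show "x \<in> (\<Union>p\<in>I. \<Omega> \<inter> grid_cube R p)" by blast
  qed
  moreover have fm: "\<Omega> \<in> fmeasurable lborel"
    using \<Omega> emeasure_bounded_finite by (auto intro!: fmeasurableI)
  then have fm': "\<Omega> \<inter> grid_cube R p \<in> fmeasurable lborel" for p
    by (intro fmeasurable_Int_fmeasurable) auto
  ultimately have "measure lborel \<Omega> \<le> measure lborel (\<Union>p\<in>I. \<Omega> \<inter> grid_cube R p)"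
    using I \<Omega> by (intro measure_mono_fmeasurable fmeasurable.finite_UN) auto
  also have "\<dots> \<le> (\<Sum>p\<in>I. measure lborel (\<Omega> \<inter> grid_cube R p))"
    using I \<Omega>(1) by (intro measure_UNION_le) auto
  finally show ?thesis using I idx by blast
qed

lemma measure_grid_cube_le:
  fixes \<Omega> :: "(real^'n::finite) set"
  assumes "R > 0" "open \<Omega>"
  shows "measure lborel (\<Omega> \<inter> grid_cube R p) \<le> R ^ CARD('n)"
proof -
  have "measure lborel (\<Omega> \<inter> grid_cube R p) \<le> measure lborel (grid_cube R p)"
    using assms emeasure_grid_cube[OF assms(1), of p]
    by (intro measure_mono_fmeasurable) (auto intro!: fmeasurableI)
  also have "\<dots> = R ^ CARD('n)"
    using emeasure_grid_cube[OF assms(1), of p] assms by (simp add: measure_def)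
  finally show ?thesis .
qed

lemma measure_grid_block_le_sum:
  fixes \<Omega> :: "(real^'n::finite) set"
  assumes \<Omega>: "open \<Omega>" "bounded \<Omega>" and R: "R > 0"
  shows "measure lborel (\<Omega> \<inter> grid_block R p) \<le>
    (\<Sum>v\<in>{v. \<forall>i. -2 \<le> v $ i \<and> v $ i < -2 + int 5}. measure lborel (\<Omega> \<inter> grid_cube R (p + v)))"
proof -
  let ?W = "{v :: int^'n. \<forall>i. -2 \<le> v $ i \<and> v $ i < -2 + int 5}"
  have W: "finite ?W" by (rule card_int_box)
  have fm: "\<Omega> \<in> fmeasurable lborel"
    using \<Omega> emeasure_bounded_finite by (auto intro!: fmeasurableI)
  then have fm': "\<Omega> \<inter> grid_cube R p \<in> fmeasurable lborel" for p
    by (intro fmeasurable_Int_fmeasurable) auto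
  have "\<Omega> \<inter> grid_block R p \<subseteq> (\<Union>v\<in>?W. \<Omega> \<inter> grid_cube R (p + v))"
    using grid_block_subset[OF R, of p] by blast
  then have "measure lborel (\<Omega> \<inter> grid_block R p) \<le> measure lborel (\<Union>v\<in>?W. \<Omega> \<inter> grid_cube R (p + v))"
    using W fm' \<Omega> by (intro measure_mono_fmeasurable fmeasurable.finite_UN) auto
  also have "\<dots> \<le> (\<Sum>v\<in>?W. measure lborel (\<Omega> \<inter> grid_cube R (p + v)))"
    using W \<Omega>(1) by (intro measure_UNION_le) auto
  finally show ?thesis .
qed

text \<open>A block consists of 5 ^ n shifted cubes, and for each fixed shift the cubes belonging to
  different indices are disjoint.\<close>

lemma sum_measure_grid_block_le:
  fixes \<Omega> :: "(real^'n::finite) set"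
  assumes \<Omega>: "open \<Omega>" "bounded \<Omega>" and R: "R > 0" and T: "finite T"
  shows "(\<Sum>p\<in>T. measure lborel (\<Omega> \<inter> grid_block R p)) \<le> 5 ^ CARD('n) * measure lborel \<Omega>"
proof -
  let ?W = "{v :: int^'n. \<forall>i. -2 \<le> v $ i \<and> v $ i < -2 + int 5}"
  let ?\<mu> = "\<lambda>p. measure lborel (\<Omega> \<inter> grid_cube R p)"
  have "(\<Sum>p\<in>T. measure lborel (\<Omega> \<inter> grid_block R p)) \<le> (\<Sum>p\<in>T. \<Sum>v\<in>?W. ?\<mu> (p + v))"
    using \<Omega> R by (intro sum_mono measure_grid_block_le_sum)
  also have "\<dots> = (\<Sum>v\<in>?W. \<Sum>p\<in>T. ?\<mu> (p + v))"
    by (rule sum.swap)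
  also have "\<dots> \<le> (\<Sum>v\<in>?W. measure lborel \<Omega>)"
  proof (intro sum_mono)
    fix v
    have "(\<Sum>p\<in>T. ?\<mu> (p + v)) = (\<Sum>q\<in>(\<lambda>p. p + v) ` T. ?\<mu> q)"
      by (subst sum.reindex) (auto simp: inj_on_def)
    also have "\<dots> \<le> measure lborel \<Omega>"
      using T \<Omega> R by (intro sum_measure_grid_cube_le) auto
    finally show "(\<Sum>p\<in>T. ?\<mu> (p + v)) \<le> measure lborel \<Omega>" .
  qed
  also have "\<dots> = 5 ^ CARD('n) * measure lborel \<Omega>"
    using card_int_box(2)[where 'n = 'n and a = "-2" and m = 5] by simp
  finally show ?thesis .
qed

lemma measure_grid_block_le:
  fixes \<Omega> :: "(real^'n::finite) set"
  assumes \<Omega>: "open \<Omega>" "bounded \<Omega>" and R: "R > 0"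
  shows "measure lborel (\<Omega> \<inter> grid_block R p) \<le> 5 ^ CARD('n) * R ^ CARD('n)"
proof -
  let ?W = "{v :: int^'n. \<forall>i. -2 \<le> v $ i \<and> v $ i < -2 + int 5}"
  have "measure lborel (\<Omega> \<inter> grid_block R p) \<le> (\<Sum>v\<in>?W. measure lborel (\<Omega> \<inter> grid_cube R (p + v)))"
    by (rule measure_grid_block_le_sum) fact+
  also have "\<dots> \<le> (\<Sum>v\<in>?W. R ^ CARD('n))"
    using \<Omega> R by (intro sum_mono measure_grid_cube_le)
  also have "\<dots> = 5 ^ CARD('n) * R ^ CARD('n)"
    using card_int_box(2)[where 'n = 'n and a = "-2" and m = 5] by simp
  finally show ?thesis .
qed

text \<open>A grid cube is active if its block carries little volume compared with the boundary in its
  core; a bump function adapted to it then has Rayleigh quotient of order \<open>1 / R\<close>.\<close>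

definition active_cube :: "(real^'n::finite) set \<Rightarrow> real \<Rightarrow> real \<Rightarrow> int^'n \<Rightarrow> bool" where
  "active_cube \<Omega> K R p \<longleftrightarrow> 0 < measure lborel (\<Omega> \<inter> grid_cube R p) \<and>
     ennreal (measure lborel (\<Omega> \<inter> grid_block R p))
       \<le> ennreal (K * R) * hausdorff_outer (CARD('n) - 1) (frontier \<Omega> \<inter> grid_core R p)"

text \<open>Isoperimetry in the core with \<open>E\<close> the filled part of cube \<open>q\<close>
  and \<open>F\<close> the empty part of cube \<open>q'\<close>. Two indices cover both sources of
  active cubes: \<open>q = q' = p\<close> for a cube at most half full, and \<open>q = p\<close>
  with \<open>q'\<close> adjacent for a fuller one. The factor 4 * 5 ^ n is what both cases
  give.\<close>

lemma active_cube_criterion: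
  assumes n: "CARD('n::finite) \<ge> 2"
  shows "\<exists>K>0. \<forall>(\<Omega>::(real^'n) set) R p q q'. open \<Omega> \<longrightarrow> bounded \<Omega> \<longrightarrow> R > 0 \<longrightarrow>
    0 < measure lborel (\<Omega> \<inter> grid_cube R p) \<longrightarrow>
    grid_cube R q \<subseteq> grid_core R p \<longrightarrow> grid_cube R q' \<subseteq> grid_core R p \<longrightarrow>
    R ^ CARD('n) * measure lborel (\<Omega> \<inter> grid_block R p) \<le>
      4 * 5 ^ CARD('n) * (measure lborel (\<Omega> \<inter> grid_cube R q) * (R ^ CARD('n) - measure lborel (\<Omega> \<inter> grid_cube R q'))) \<longrightarrow>
    active_cube \<Omega> K R p"
proof -
  let ?n = "CARD('n)"
  obtain K where K: "K > 0" and iso: "\<forall>(a::real^'n) b S l E F. l > 0 \<longrightarrow> (\<forall>i. b $ i = a $ i + l) \<longrightarrow>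
     E \<subseteq> cbox a b \<inter> S \<longrightarrow> F \<subseteq> cbox a b - S \<longrightarrow> E \<in> sets borel \<longrightarrow> F \<in> sets borel \<longrightarrow>
     emeasure lborel E * emeasure lborel F \<le>
       ennreal (K * l ^ (?n + 1)) * hausdorff_outer (?n - 1) (frontier S \<inter> cbox a b)"
    using relative_isoperimetric[OF n] by (elim exE conjE) (rule that)
  define K' where "K' = 4 * 5 ^ ?n * (K * 3 ^ (?n + 1))"
  have K': "K' > 0" using K by (simp add: K'_def)
  show ?thesis
  proof (intro exI[of _ K'] conjI K' allI impI)
    fix \<Omega> :: "(real^'n) set" and R :: real and p q q' :: "int^'n"
    assume \<Omega>: "open \<Omega>" "bounded \<Omega>" and R: "R > 0" and pos: "0 < measure lborel (\<Omega> \<inter> grid_cube R p)"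
      and sub: "grid_cube R q \<subseteq> grid_core R p" "grid_cube R q' \<subseteq> grid_core R p"
      and le: "R ^ ?n * measure lborel (\<Omega> \<inter> grid_block R p) \<le>
      4 * 5 ^ ?n * (measure lborel (\<Omega> \<inter> grid_cube R q) * (R ^ ?n - measure lborel (\<Omega> \<inter> grid_cube R q')))"
    let ?h = "hausdorff_outer (?n - 1) (frontier \<Omega> \<inter> grid_core R p)"
    let ?\<mu> = "\<lambda>A. measure lborel (\<Omega> \<inter> A)"
    have fm: "\<Omega> \<in> fmeasurable lborel"
      using \<Omega> emeasure_bounded_finite by (auto intro!: fmeasurableI)
    then have fm': "\<Omega> \<inter> grid_cube R p \<in> fmeasurable lborel" for p
      by (intro fmeasurable_Int_fmeasurable) auto
    have em: "emeasure lborel (\<Omega> \<inter> grid_cube R r) = ennreal (?\<mu> (grid_cube R r))" for r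
      using fm' by (simp add: emeasure_eq_measure2)
    have "emeasure lborel (grid_cube R q' - \<Omega>) = emeasure lborel (grid_cube R q' - (\<Omega> \<inter> grid_cube R q'))"
      by (simp add: Diff_Int)
    also have "\<dots> = emeasure lborel (grid_cube R q') - emeasure lborel (\<Omega> \<inter> grid_cube R q')"
      using \<Omega> em by (intro emeasure_Diff) auto
    also have "\<dots> = ennreal (R ^ ?n - ?\<mu> (grid_cube R q'))"
      using R by (simp add: em emeasure_grid_cube ennreal_minus)
    finally have emF: "emeasure lborel (grid_cube R q' - \<Omega>) = ennreal (R ^ ?n - ?\<mu> (grid_cube R q'))" .
    let ?x = "?\<mu> (grid_cube R q) * (R ^ ?n - ?\<mu> (grid_cube R q'))"
    have "ennreal ?x = emeasure lborel (\<Omega> \<inter> grid_cube R q) * emeasure lborel (grid_cube R q' - \<Omega>)"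
      by (simp add: em emF ennreal_mult')
    also have "\<dots> \<le> ennreal (K * (3 * R) ^ (?n + 1)) * ?h"
      unfolding grid_core_def
      using R sub \<Omega> by (intro iso[rule_format]) (auto simp: grid_core_def algebra_simps)
    finally have x: "ennreal ?x \<le> ennreal (K * (3 * R) ^ (?n + 1)) * ?h" .
    \<comment> \<open>An infinite boundary measure makes the claim trivial; otherwise R ^ n cancels
      in the reals and one factor \<open>R\<close> of (3 * R) ^ (n + 1) survives.\<close>
    have "ennreal (?\<mu> (grid_block R p)) \<le> ennreal (K' * R) * ?h"
    proof (cases "?h = top")
      case True
      then show ?thesis using K' R by (simp add: ennreal_mult_top)
    next
      case False
      then obtain t where t: "t \<ge> 0" "?h = ennreal t" by (cases ?h) auto
      have "ennreal ?x \<le> ennreal (K * (3 * R) ^ (?n + 1) * t)"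
        using x t K R by (simp add: ennreal_mult')
      then have "?x \<le> K * (3 * R) ^ (?n + 1) * t"
        using t K R by (subst (asm) ennreal_le_iff) auto
      then have "R ^ ?n * ?\<mu> (grid_block R p) \<le> 4 * 5 ^ ?n * (K * (3 * R) ^ (?n + 1) * t)"
        by (intro order_trans[OF le] mult_left_mono) auto
      also have "\<dots> = R ^ ?n * (K' * R * t)"
        by (simp add: K'_def power_mult_distrib)
      finally have "?\<mu> (grid_block R p) \<le> K' * R * t"
        using R by simp
      then have "ennreal (?\<mu> (grid_block R p)) \<le> ennreal (K' * R * t)" by (rule ennreal_leI)
      then show ?thesis using t K' R by (simp add: ennreal_mult')
    qed
    then show "active_cube \<Omega> K' R p" using pos by (simp add: active_cube_def)
  qed
qed


text \<open>The factor 4 is 2 * 2: half of the volume may be lost to cubes without doubling, and the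
  rest is shared by two families of cubes. The power n / (n - 1) undoes the isoperimetric exponent 1
  - 1/n, and 8 * n is the loss in the discrete isoperimetric step.\<close>

lemma exists_many_active_cubes:
  assumes n: "CARD('n::finite) \<ge> 2"
  shows "\<exists>K>0. \<forall>(\<Omega>::(real^'n) set) R (N::nat). open \<Omega> \<longrightarrow> bounded \<Omega> \<longrightarrow> R > 0 \<longrightarrow> N \<ge> 1 \<longrightarrow>
    4 * R ^ CARD('n) * (8 * real CARD('n) * real N) powr (real CARD('n) / (real CARD('n) - 1)) \<le> measure lborel \<Omega> \<longrightarrow>
    (\<exists>A. finite A \<and> N \<le> card A \<and> (\<forall>p\<in>A. active_cube \<Omega> K R p))"
proof -
  let ?n = "CARD('n)"
  obtain K where K: "K > 0" and crit: "\<forall>(\<Omega>::(real^'n) set) R p q q'. open \<Omega> \<longrightarrow> bounded \<Omega> \<longrightarrow> R > 0 \<longrightarrow>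
    0 < measure lborel (\<Omega> \<inter> grid_cube R p) \<longrightarrow>
    grid_cube R q \<subseteq> grid_core R p \<longrightarrow> grid_cube R q' \<subseteq> grid_core R p \<longrightarrow>
    R ^ ?n * measure lborel (\<Omega> \<inter> grid_block R p) \<le>
      4 * 5 ^ ?n * (measure lborel (\<Omega> \<inter> grid_cube R q) * (R ^ ?n - measure lborel (\<Omega> \<inter> grid_cube R q'))) \<longrightarrow>
    active_cube \<Omega> K R p"
    using active_cube_criterion[OF n] by (elim exE conjE) (rule that)
  show ?thesis
  proof (intro exI[of _ K] conjI K allI impI)
    fix \<Omega> :: "(real^'n) set" and R :: real and N :: nat
    assume \<Omega>: "open \<Omega>" "bounded \<Omega>" and R: "R > 0" and N: "N \<ge> 1"
    define M where "M = (8 * real ?n * real N) powr (real ?n / (real ?n - 1))"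
    assume "4 * R ^ ?n * (8 * real ?n * real N) powr (real ?n / (real ?n - 1)) \<le> measure lborel \<Omega>"
    then have big: "4 * R ^ ?n * M \<le> measure lborel \<Omega>" by (simp add: M_def)
    have Rn: "R ^ ?n > 0" using R by simp
    define \<mu> where "\<mu> p = measure lborel (\<Omega> \<inter> grid_cube R p)" for p
    define \<beta> where "\<beta> p = measure lborel (\<Omega> \<inter> grid_block R p)" for p
    have \<mu>: "0 \<le> \<mu> p" "\<mu> p \<le> R ^ ?n" for p
      using measure_grid_cube_le[OF R \<Omega>(1)] by (auto simp: \<mu>_def)
    have \<beta>: "0 \<le> \<beta> p" "\<beta> p \<le> 5 ^ ?n * R ^ ?n" for p
      using measure_grid_block_le[OF \<Omega> R] by (auto simp: \<beta>_def)
    obtain I where I: "finite I" "\<And>p. p \<notin> I \<Longrightarrow> \<mu> p = 0" "measure lborel \<Omega> \<le> (\<Sum>p\<in>I. \<mu> p)"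
      using measure_eq_sum_grid_cube[OF \<Omega> R] unfolding \<mu>_def by fastforce
    have active: "active_cube \<Omega> K R p"
      if "0 < \<mu> p" "grid_cube R q \<subseteq> grid_core R p" "grid_cube R q' \<subseteq> grid_core R p"
        "R ^ ?n * \<beta> p \<le> 4 * 5 ^ ?n * (\<mu> q * (R ^ ?n - \<mu> q'))" for p q q'
      using crit[rule_format, OF \<Omega> R] that unfolding \<mu>_def \<beta>_def by blast
    define A where "A = {p \<in> I. active_cube \<Omega> K R p}"
    define Lw where "Lw = {p \<in> I. 0 < \<mu> p \<and> \<mu> p \<le> R ^ ?n / 2 \<and> \<beta> p \<le> 2 * 5 ^ ?n * \<mu> p}"
    define Hi where "Hi = {p \<in> I. R ^ ?n / 2 < \<mu> p}"
    have fin: "finite A" "finite Lw" "finite Hi" using I by (auto simp: A_def Lw_def Hi_def)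
    \<comment> \<open>A nonempty cube in neither family violates doubling and is charged to its
      block; summing the blocks with their overlap 5 ^ n costs at most half of the volume.\<close>
    have "\<mu> p \<le> R ^ ?n * of_bool (p \<in> Lw) + R ^ ?n * of_bool (p \<in> Hi) + \<beta> p / (2 * 5 ^ ?n)" if "p \<in> I" for p
    proof (cases "p \<in> Lw \<or> p \<in> Hi")
      case True
      have "\<beta> p / (2 * 5 ^ ?n) \<ge> 0" using \<beta> by simp
      then show ?thesis using True \<mu>[of p] Rn by auto
    next
      case False
      have "\<mu> p = 0 \<or> 2 * 5 ^ ?n * \<mu> p < \<beta> p"
        using False that \<mu>(1)[of p] by (auto simp: Lw_def Hi_def not_le)
      then have "\<mu> p \<le> \<beta> p / (2 * 5 ^ ?n)"
        using \<beta>(1)[of p] by (auto simp: field_simps)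
      then show ?thesis using False by simp
    qed
    then have "(\<Sum>p\<in>I. \<mu> p) \<le> (\<Sum>p\<in>I. R ^ ?n * of_bool (p \<in> Lw) + R ^ ?n * of_bool (p \<in> Hi) + \<beta> p / (2 * 5 ^ ?n))"
      by (intro sum_mono)
    also have "\<dots> = R ^ ?n * card Lw + R ^ ?n * card Hi + (\<Sum>p\<in>I. \<beta> p) / (2 * 5 ^ ?n)"
    proof -
      have "I \<inter> {p. p \<in> Lw} = Lw" "I \<inter> {p. p \<in> Hi} = Hi" by (auto simp: Lw_def Hi_def)
      then have "(\<Sum>p\<in>I. of_bool (p \<in> Lw)) = real (card Lw)" "(\<Sum>p\<in>I. of_bool (p \<in> Hi)) = real (card Hi)"
        using I(1) by (simp_all add: sum_of_bool_eq)
      then show ?thesis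
        by (simp only: sum.distrib sum_distrib_left[symmetric] sum_divide_distrib[symmetric])
    qed
    also have "(\<Sum>p\<in>I. \<beta> p) / (2 * 5 ^ ?n) \<le> measure lborel \<Omega> / 2"
      using sum_measure_grid_block_le[OF \<Omega> R I(1)] by (simp add: \<beta>_def field_simps)
    finally have "measure lborel \<Omega> / 2 \<le> R ^ ?n * (real (card Lw) + real (card Hi))"
      using I(3) by (simp add: algebra_simps)
    then have "R ^ ?n * (2 * M) \<le> R ^ ?n * (real (card Lw) + real (card Hi))"
      using big by (simp add: algebra_simps)
    then have "2 * M \<le> real (card Lw) + real (card Hi)" using Rn by simp
    then consider "M \<le> real (card Lw)" | "M \<le> real (card Hi)" by linarith
    then have "N \<le> card A"
    proof cases
      case 1
      have "p \<in> A" if p: "p \<in> Lw" for p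
      proof -
        have "R ^ ?n * \<beta> p \<le> R ^ ?n * (2 * 5 ^ ?n * \<mu> p)"
          using p Rn by (intro mult_left_mono) (auto simp: Lw_def)
        also have "\<dots> = 4 * 5 ^ ?n * (\<mu> p * (R ^ ?n / 2))" by simp
        also have "\<dots> \<le> 4 * 5 ^ ?n * (\<mu> p * (R ^ ?n - \<mu> p))"
          using p by (intro mult_left_mono) (auto simp: Lw_def)
        finally have "active_cube \<Omega> K R p"
          using p by (intro active[of p p p] grid_cube_subset_core R) (auto simp: Lw_def)
        then show ?thesis using p by (simp add: A_def Lw_def)
      qed
      then have "card Lw \<le> card A" using fin by (intro card_mono) auto
      moreover have "real N \<le> M"
      proof -
        have "8 * real ?n * real N \<ge> 1 * real N"
          using n by (intro mult_right_mono) auto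
        then have "real N \<le> (8 * real ?n * real N) powr 1" using N by simp
        also have "\<dots> \<le> M"
          unfolding M_def using n N by (intro powr_mono) (auto simp: field_simps intro: order_trans[of _ "real N"])
        finally show ?thesis .
      qed
      ultimately show ?thesis using 1 by linarith
    next
      case 2
      define m where "m = real (card Hi)"
      have "M > 0" unfolding M_def using n N by simp
      then have m: "m \<ge> 1" using 2 unfolding m_def by (cases "card Hi") auto
      \<comment> \<open>The least side with L ^ n >= 2 * m. Rounding up at most doubles a number
        that is at least 1, and 2 powr (1 / n) <= 2, whence the factor 4 below.\<close>
      define L where "L = nat \<lceil>(2 * m) powr (1 / ?n)\<rceil>"
      have L1: "(2 * m) powr (1 / ?n) \<le> real L"
        unfolding L_def by (simp add: real_nat_ceiling_ge)
      have L2: "real L \<le> 4 * m powr (1 / ?n)"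
      proof -
        have "(2 * m) powr (1 / ?n) \<ge> 1" using m by (intro ge_one_powr_ge_zero) auto
        then have "real L \<le> 2 * (2 * m) powr (1 / ?n)" unfolding L_def by linarith
        also have "(2 * m) powr (1 / ?n) = 2 powr (1 / ?n) * m powr (1 / ?n)"
          using m by (simp add: powr_mult)
        finally have *: "real L \<le> 2 powr (1 / ?n) * (2 * m powr (1 / ?n))" by simp
        have "2 powr (1 / ?n) \<le> 2 powr (1::real)" using n by (intro powr_mono) auto
        then have "2 powr (1 / ?n) * (2 * m powr (1 / ?n)) \<le> 2 * (2 * m powr (1 / ?n))"
          by (intro mult_right_mono) auto
        also have "\<dots> = 4 * m powr (1 / ?n)" by simp
        finally show ?thesis using * by (rule order_trans[rotated])
      qed
      have "2 * m = ((2 * m) powr (1 / ?n)) ^ ?n"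
        using m by (simp add: powr_realpow[symmetric] powr_powr)
      also have "\<dots> \<le> real L ^ ?n" using L1 by (intro power_mono) auto
      finally have "real (2 * card Hi) \<le> real (L ^ ?n)" by (simp add: m_def)
      then have "2 * card Hi \<le> L ^ ?n" by (simp only: of_nat_le_iff)
      from discrete_isoperimetric[OF fin(3) this]
      have "card Hi \<le> 2 * L * (\<Sum>i\<in>UNIV. exit_count Hi (axis i 1))" .
      also have "\<dots> \<le> 2 * L * (\<Sum>i\<in>(UNIV::'n set). card A)"
      proof (intro mult_left_mono sum_mono)
        fix i :: 'n
        have "p \<in> A" if p: "p \<in> Hi" "p + axis i 1 \<notin> Hi" for p
        proof -
          let ?q = "p + axis i 1"
          \<comment> \<open>The neighbour may fall outside the finite index set \<open>I\<close>,
            but then it contains nothing of \<Omega>.\<close>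
          have q: "\<mu> ?q \<le> R ^ ?n / 2" using p I(2)[of ?q] Rn by (cases "?q \<in> I") (auto simp: Hi_def)
          have "R ^ ?n * \<beta> p \<le> R ^ ?n * (5 ^ ?n * R ^ ?n)"
            using \<beta> Rn by (intro mult_left_mono) auto
          also have "\<dots> = 4 * 5 ^ ?n * ((R ^ ?n / 2) * (R ^ ?n / 2))" by simp
          also have "\<dots> \<le> 4 * 5 ^ ?n * (\<mu> p * (R ^ ?n - \<mu> ?q))"
            using p q Rn by (intro mult_left_mono mult_mono) (auto simp: Hi_def)
          finally have "active_cube \<Omega> K R p"
            using p Rn by (intro active[of p p ?q] grid_cube_subset_core grid_cube_shift_subset_core R) (auto simp: Hi_def)
          then show ?thesis using p by (simp add: A_def Hi_def)
        qed
        then show "exit_count Hi (axis i 1) \<le> card A"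
          unfolding exit_count_def using fin by (intro card_mono) auto
      qed auto
      also have "\<dots> = 2 * L * ?n * card A" by simp
      finally have "real (card Hi) \<le> real (2 * L * ?n * card A)" by (simp only: of_nat_le_iff)
      then have "m \<le> real L * (2 * ?n * real (card A))" by (simp add: m_def algebra_simps)
      also have "\<dots> \<le> 4 * m powr (1 / ?n) * (2 * ?n * real (card A))"
        using L2 by (intro mult_right_mono) auto
      finally have "m \<le> m powr (1 / ?n) * (8 * ?n * real (card A))" by (simp add: algebra_simps)
      moreover have "m = m powr (1 / ?n) * m powr (1 - 1 / ?n)"
        using m by (simp add: powr_add[symmetric])
      ultimately have "m powr (1 / ?n) * m powr (1 - 1 / ?n) \<le> m powr (1 / ?n) * (8 * ?n * real (card A))"
        by simp
      moreover have "m powr (1 / ?n) > 0" using m by simp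
      ultimately have up: "m powr (1 - 1 / ?n) \<le> 8 * ?n * real (card A)"
        by (simp only: mult_le_cancel_left_pos)
      have "8 * real ?n * real N = M powr (1 - 1 / ?n)"
      proof -
        have "real ?n / (real ?n - 1) * (1 - 1 / ?n) = 1" using n by (simp add: field_simps)
        then show ?thesis using n N by (simp add: M_def powr_powr)
      qed
      also have "\<dots> \<le> m powr (1 - 1 / ?n)"
        using 2 \<open>M > 0\<close> n by (intro powr_mono2) (auto simp: m_def)
      also have "\<dots> \<le> 8 * ?n * real (card A)" by (rule up)
      finally show ?thesis using n by simp
    qed
    then show "\<exists>A. finite A \<and> N \<le> card A \<and> (\<forall>p\<in>A. active_cube \<Omega> K R p)"
      using fin(1) by (intro exI[of _ A]) (auto simp: A_def)
  qed
qed

section \<open>Bounding the eigenvalues\<close>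

text \<open>The assumption says that at most one summand is nonzero, as for disjointly supported
  functions evaluated at a point; hence there are no cross terms.\<close>

lemma norm_sum_power2_orthogonal:
  fixes a :: "'i \<Rightarrow> 'a::real_normed_vector"
  assumes "finite I" "\<And>i j. i \<in> I \<Longrightarrow> j \<in> I \<Longrightarrow> a i \<noteq> 0 \<Longrightarrow> a j \<noteq> 0 \<Longrightarrow> i = j"
  shows "(norm (\<Sum>i\<in>I. a i))\<^sup>2 = (\<Sum>i\<in>I. (norm (a i))\<^sup>2)"
proof (cases "\<exists>i\<in>I. a i \<noteq> 0")
  case True
  then obtain i where i: "i \<in> I" "a i \<noteq> 0" by blast
  then have "(\<Sum>j\<in>I - {i}. a j) = 0" "(\<Sum>j\<in>I - {i}. (norm (a j))\<^sup>2) = 0"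
    using assms(2) by (auto intro!: sum.neutral)
  then show ?thesis using i assms(1) by (simp add: sum.remove[of I i])
qed (auto intro!: sum.neutral)

lemma frontier_Int_core_borel: "frontier \<Omega> \<inter> grid_core R p \<in> sets borel"
  by (auto simp: grid_core_def intro!: borel_closed closed_Int)

lemma nn_integral_surface_measure:
  "CARD('n::finite) \<ge> 2 \<Longrightarrow> (\<integral>\<^sup>+x. f x \<partial>surface_measure (\<Omega>::(real^'n) set)) =
     (\<integral>\<^sup>+x. f x * indicator (frontier \<Omega>) x \<partial>hausdorff_measure (CARD('n) - 1))"
  unfolding surface_measure_def
  by (intro nn_integral_restrict_space) (simp add: space_hausdorff_measure sets_hausdorff_measure borel_closed)

text \<open>With h the boundary measure in the core, a bump has energy at most (G / R)^2 * (K * R *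
  h) by activity, and boundary norm squared at least m^2 * h. Their ratio is \<open>C / R\<close>
  for every bump, and since the separation of \<open>B\<close> makes the blocks disjoint, the same
  ratio bounds every combination.\<close>

lemma steklov_eigenvalue_le:
  assumes n: "CARD('n::finite) \<ge> 2" and K: "K > 0"
  shows "\<exists>C>0. \<forall>(\<Omega>::(real^'n) set) R B (k::nat). open \<Omega> \<longrightarrow> bounded \<Omega> \<longrightarrow> R > 0 \<longrightarrow> finite B \<longrightarrow> card B = k \<longrightarrow>
    (\<forall>p\<in>B. active_cube \<Omega> K R p) \<longrightarrow>
    (\<forall>p\<in>B. \<forall>q\<in>B. p \<noteq> q \<longrightarrow> (\<exists>i. \<bar>p $ i - q $ i\<bar> \<ge> 5)) \<longrightarrow>
    steklov_eigenvalue \<Omega> k \<le> ennreal (C / R)"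
proof -
  obtain m G where m: "m > 0" and G: "G > 0"
    and bm: "\<forall>y::real^'n. (\<forall>j. -1 \<le> y $ j \<and> y $ j \<le> 2) \<longrightarrow> m \<le> bump y"
    and bG: "\<forall>y::real^'n. norm (gradient bump y) \<le> G"
    using bump_bounds by (elim exE conjE) (rule that)
  define C where "C = G\<^sup>2 * K / m\<^sup>2"
  have C: "C > 0" using m G K by (simp add: C_def)
  show ?thesis
  proof (intro exI[of _ C] conjI C allI impI)
    fix \<Omega> :: "(real^'n) set" and R :: real and B :: "(int^'n) set" and k :: nat
    assume \<Omega>: "open \<Omega>" "bounded \<Omega>" and R: "R > 0" and B: "finite B" "card B = k"
      and act: "\<forall>p\<in>B. active_cube \<Omega> K R p"
      and sep: "\<forall>p\<in>B. \<forall>q\<in>B. p \<noteq> q \<longrightarrow> (\<exists>i. \<bar>p $ i - q $ i\<bar> \<ge> 5)"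
    obtain f where f: "bij_betw f {..<k} B"
      using ex_bij_betw_nat_finite[OF B(1)] B(2) by (auto simp: atLeast0LessThan)
    define ctr where "ctr j = (\<chi> i. R * f j $ i)" for j
    define \<phi> where "\<phi> j x = bump ((1 / R) *\<^sub>R (x - ctr j))" for j x
    have coord: "((1 / R) *\<^sub>R (x - ctr j)) $ i = x $ i / R - f j $ i" for x j i
      using R by (simp add: ctr_def field_simps)
    have fB: "f j \<in> B" if "j < k" for j using f that by (auto simp: bij_betw_def)
    have smooth: "smooth_on UNIV (\<phi> j)" for j
      unfolding \<phi>_def[abs_def] by (rule smooth_on_bump)
    have nonneg: "0 \<le> \<phi> j x" for j x by (simp add: \<phi>_def bump_nonneg)
    have supp: "x \<in> grid_block R (f j)" if "\<phi> j x \<noteq> 0" for j x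
    proof -
      have "0 < \<phi> j x" using that nonneg[of j x] by simp
      then have *: "-2 < x $ i / R - f j $ i" "x $ i / R - f j $ i < 3" for i
        unfolding \<phi>_def bump_pos_iff coord by auto
      have "R * (f j $ i - 2) \<le> x $ i \<and> x $ i < R * (f j $ i + 3)" for i
      proof -
        have "real_of_int (f j $ i) - 2 < x $ i / R" "x $ i / R < real_of_int (f j $ i) + 3"
          using *[of i] by linarith+
        then show ?thesis using R by (simp add: field_simps)
      qed
      then show ?thesis by (simp add: grid_block_def)
    qed
    have core: "m \<le> \<phi> j x" if "x \<in> grid_core R (f j)" for j x
    proof -
      have "R * (f j $ i - 1) \<le> x $ i" "x $ i \<le> R * (f j $ i + 2)" for i
        using that by (auto simp: grid_core_def mem_box_cart)
      then have *: "f j $ i - 1 \<le> x $ i / R" "x $ i / R \<le> f j $ i + 2" for i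
        using R by (simp_all add: field_simps)
      have "-1 \<le> x $ i / R - f j $ i \<and> x $ i / R - f j $ i \<le> 2" for i
        using *[of i] by (simp add: algebra_simps)
      then have "\<forall>i. -1 \<le> ((1 / R) *\<^sub>R (x - ctr j)) $ i \<and> ((1 / R) *\<^sub>R (x - ctr j)) $ i \<le> 2"
        unfolding coord by blast
      then show ?thesis
        unfolding \<phi>_def using bm by blast
    qed
    \<comment> \<open>Gradients thereby inherit the pointwise disjointness of the bumps.\<close>
    have grad0: "gradient (\<phi> j) x = 0" if "\<phi> j x = 0" for j x
      using gradient_eq_0_at_zero[OF smooth_on_UNIV_differentiable[OF smooth] nonneg that] .
    have gradG: "norm (gradient (\<phi> j) x) \<le> G / R" for j x
      using bG R by (simp add: \<phi>_def[abs_def] bump_scaled_gradient divide_right_mono)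
    have disj: "i = j" if ij: "i < k" "j < k" "\<phi> i x \<noteq> 0" "\<phi> j x \<noteq> 0" for i j x
    proof (rule ccontr)
      assume "i \<noteq> j"
      then have "f i \<noteq> f j" using f that by (auto simp: bij_betw_def inj_on_def)
      then obtain l where "\<bar>f i $ l - f j $ l\<bar> \<ge> 5" using sep fB[OF ij(1)] fB[OF ij(2)] by blast
      from grid_block_disjoint[OF R this] show False using supp that by blast
    qed
    let ?H = "hausdorff_measure (CARD('n) - 1) :: (real^'n) measure"
    let ?h = "\<lambda>j. hausdorff_outer (CARD('n) - 1) (frontier \<Omega> \<inter> grid_core R (f j))"
    let ?\<beta> = "\<lambda>j. measure lborel (\<Omega> \<inter> grid_block R (f j))"
    have \<beta>_le: "ennreal (?\<beta> j) \<le> ennreal (K * R) * ?h j" and cube_pos: "0 < measure lborel (\<Omega> \<inter> grid_cube R (f j))" if "j < k" for j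
      using act fB[OF that] by (auto simp: active_cube_def)
    have fm: "\<Omega> \<in> fmeasurable lborel"
      using \<Omega> emeasure_bounded_finite by (auto intro!: fmeasurableI)
    then have fm': "\<Omega> \<inter> A \<in> fmeasurable lborel" if "A \<in> sets borel" for A
      using that by (intro fmeasurable_Int_fmeasurable) auto
    have cube_core: "grid_cube R p \<subseteq> grid_core R p" for p :: "int^'n"
      by (rule grid_cube_subset_core[OF R])
    have H1: "H1_with_gradient \<Omega> (\<phi> j) (gradient (\<phi> j))" "has_trace \<Omega> (\<phi> j) (gradient (\<phi> j)) (\<phi> j)" for j
      using H1_with_gradient_smooth[OF smooth \<Omega>] has_trace_smooth[OF smooth] by auto
    \<comment> \<open>An active cube contains volume of \<Omega>, so its activity inequality forces
      boundary into the core. This keeps every denominator positive and excludes the value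
      \<open>top\<close> of the quotient.\<close>
    have pos: "0 < ?h j" if "j < k" for j
    proof -
      have "grid_cube R (f j) \<subseteq> grid_block R (f j)"
      proof
        fix x assume "x \<in> grid_cube R (f j)"
        then have "\<phi> j x \<ge> m" using cube_core core by blast
        then show "x \<in> grid_block R (f j)" using m by (intro supp) auto
      qed
      then have "measure lborel (\<Omega> \<inter> grid_cube R (f j)) \<le> ?\<beta> j"
        using fm' \<Omega> by (intro measure_mono_fmeasurable) auto
      then have "0 < ennreal (?\<beta> j)" using cube_pos[OF that] by simp
      also have "\<dots> \<le> ennreal (K * R) * ?h j" by (rule \<beta>_le[OF that])
      finally show ?thesis by (cases "?h j = 0") (auto simp: zero_less_iff_neq_zero)
    qed
    \<comment> \<open>On the part of \<Omega> inside cube \<open>f i\<close>, which has positive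
      measure, only the bump \<open>\<phi> i\<close> is nonzero.\<close>
    have indep: "lin_indep_ae \<Omega> k \<phi>"
      unfolding lin_indep_ae_def
    proof (intro allI impI)
      fix c :: "nat \<Rightarrow> real" and i
      assume ae: "AE x in lebesgue_on \<Omega>. (\<Sum>i<k. c i * \<phi> i x) = 0" and i: "i < k"
      show "c i = 0"
      proof (rule ccontr)
        assume ci: "c i \<noteq> 0"
        have "AE x in lebesgue. x \<in> \<Omega> \<longrightarrow> (\<Sum>i<k. c i * \<phi> i x) = 0"
          using ae \<Omega> lmeasurable_open[OF \<Omega>(2,1)] by (simp add: AE_restrict_space_iff)
        moreover have "x \<notin> \<Omega> \<inter> grid_cube R (f i)" if "x \<in> \<Omega> \<longrightarrow> (\<Sum>i<k. c i * \<phi> i x) = 0" for x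
        proof
          assume x: "x \<in> \<Omega> \<inter> grid_cube R (f i)"
          then have "\<phi> i x \<ge> m" using cube_core core by blast
          then have nz: "\<phi> i x \<noteq> 0" using m by simp
          have "(\<Sum>j<k. c j * \<phi> j x) = (\<Sum>j\<in>{i}. c j * \<phi> j x)"
            using disj[OF _ i _ nz] i by (intro sum.mono_neutral_right) auto
          then show False using that x ci nz by simp
        qed
        ultimately have "AE x in lebesgue. x \<notin> \<Omega> \<inter> grid_cube R (f i)" by (auto elim: AE_mp)
        moreover have "\<Omega> \<inter> grid_cube R (f i) \<in> sets lborel" using \<Omega> by auto
        ultimately have "emeasure lborel (\<Omega> \<inter> grid_cube R (f i)) = 0"
          by (subst AE_iff_measurable[symmetric, of _ _ "\<lambda>x. x \<notin> \<Omega> \<inter> grid_cube R (f i)"])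
            (auto simp: AE_completion_iff)
        then show False using cube_pos[OF i] by (simp add: measure_def)
      qed
    qed
    have quot: "steklov_quotient \<Omega> (\<lambda>x. \<Sum>i<k. c i *\<^sub>R gradient (\<phi> i) x) (\<lambda>x. \<Sum>i<k. c i * \<phi> i x) \<le> ennreal (C / R)"
      if c: "\<exists>i<k. c i \<noteq> 0" for c :: "nat \<Rightarrow> real"
    proof -
      let ?num = "\<integral>\<^sup>+x. ennreal ((norm (\<Sum>i<k. c i *\<^sub>R gradient (\<phi> i) x))\<^sup>2) \<partial>lebesgue_on \<Omega>"
      let ?den = "\<integral>\<^sup>+x. ennreal ((\<Sum>i<k. c i * \<phi> i x)\<^sup>2) \<partial>surface_measure \<Omega>"
      have "?num = (\<integral>\<^sup>+x. ennreal ((norm (\<Sum>i<k. c i *\<^sub>R gradient (\<phi> i) x))\<^sup>2) * indicator \<Omega> x \<partial>lborel)"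
        using lmeasurable_open[OF \<Omega>(2,1)] by (subst nn_integral_restrict_space) (auto simp: nn_integral_completion)
      also have "\<dots> \<le> (\<integral>\<^sup>+x. (\<Sum>i<k. ennreal ((c i)\<^sup>2 * (G / R)\<^sup>2) * indicator (\<Omega> \<inter> grid_block R (f i)) x) \<partial>lborel)"
      proof (intro nn_integral_mono)
        fix x
        have "(norm (\<Sum>i<k. c i *\<^sub>R gradient (\<phi> i) x))\<^sup>2 = (\<Sum>i<k. (norm (c i *\<^sub>R gradient (\<phi> i) x))\<^sup>2)"
          using grad0 disj by (intro norm_sum_power2_orthogonal) (auto, metis)
        also have "\<dots> \<le> (\<Sum>i<k. (c i)\<^sup>2 * (G / R)\<^sup>2 * indicator (grid_block R (f i)) x)"
        proof (intro sum_mono)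
          fix i
          show "(norm (c i *\<^sub>R gradient (\<phi> i) x))\<^sup>2 \<le> (c i)\<^sup>2 * (G / R)\<^sup>2 * indicator (grid_block R (f i)) x"
          proof (cases "\<phi> i x = 0")
            case True
            then show ?thesis by (simp add: grad0)
          next
            case False
            have "(norm (gradient (\<phi> i) x))\<^sup>2 \<le> (G / R)\<^sup>2" using gradG by (intro power_mono) auto
            then show ?thesis using supp[OF False] by (simp add: power_mult_distrib mult_left_mono)
          qed
        qed
        finally have "ennreal ((norm (\<Sum>i<k. c i *\<^sub>R gradient (\<phi> i) x))\<^sup>2) \<le>
           ennreal (\<Sum>i<k. (c i)\<^sup>2 * (G / R)\<^sup>2 * indicator (grid_block R (f i)) x)" by (rule ennreal_leI)
        also have "\<dots> = (\<Sum>i<k. ennreal ((c i)\<^sup>2 * (G / R)\<^sup>2) * indicator (grid_block R (f i)) x)"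
          by (subst sum_ennreal[symmetric]) (auto simp: indicator_def intro!: sum.cong)
        finally have "ennreal ((norm (\<Sum>i<k. c i *\<^sub>R gradient (\<phi> i) x))\<^sup>2) * indicator \<Omega> x \<le>
          (\<Sum>i<k. ennreal ((c i)\<^sup>2 * (G / R)\<^sup>2) * indicator (grid_block R (f i)) x) * indicator \<Omega> x"
          by (rule mult_right_mono) simp
        also have "\<dots> = (\<Sum>i<k. ennreal ((c i)\<^sup>2 * (G / R)\<^sup>2) * indicator (\<Omega> \<inter> grid_block R (f i)) x)"
          by (simp add: sum_distrib_right indicator_def)
        finally show "ennreal ((norm (\<Sum>i<k. c i *\<^sub>R gradient (\<phi> i) x))\<^sup>2) * indicator \<Omega> x \<le>
          (\<Sum>i<k. ennreal ((c i)\<^sup>2 * (G / R)\<^sup>2) * indicator (\<Omega> \<inter> grid_block R (f i)) x)" .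
      qed
      also have "\<dots> = (\<Sum>i<k. ennreal ((c i)\<^sup>2 * (G / R)\<^sup>2) * emeasure lborel (\<Omega> \<inter> grid_block R (f i)))"
        using \<Omega>(1) by (subst nn_integral_sum) (auto simp: nn_integral_cmult_indicator
            intro!: borel_measurable_times_ennreal borel_measurable_indicator)
      also have "\<dots> = (\<Sum>i<k. ennreal ((c i)\<^sup>2 * (G / R)\<^sup>2) * ennreal (?\<beta> i))"
        using fm' by (simp add: emeasure_eq_measure2)
      also have "\<dots> \<le> (\<Sum>i<k. ennreal ((c i)\<^sup>2 * (G / R)\<^sup>2) * (ennreal (K * R) * ?h i))"
        by (intro sum_mono mult_left_mono \<beta>_le) auto
      also have "\<dots> = (\<Sum>i<k. ennreal (C / R) * (ennreal ((c i)\<^sup>2 * m\<^sup>2) * ?h i))"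
      proof (intro sum.cong refl)
        fix i
        have "((c i)\<^sup>2 * (G / R)\<^sup>2) * (K * R) = (C / R) * ((c i)\<^sup>2 * m\<^sup>2)"
          using m R by (simp add: C_def field_simps power2_eq_square)
        then have "ennreal ((c i)\<^sup>2 * (G / R)\<^sup>2) * ennreal (K * R) = ennreal (C / R) * ennreal ((c i)\<^sup>2 * m\<^sup>2)"
          using K R C by (subst (1 2) ennreal_mult''[symmetric]) auto
        then show "ennreal ((c i)\<^sup>2 * (G / R)\<^sup>2) * (ennreal (K * R) * ?h i) = ennreal (C / R) * (ennreal ((c i)\<^sup>2 * m\<^sup>2) * ?h i)"
          by (simp only: mult.assoc[symmetric])
      qed
      also have "\<dots> = ennreal (C / R) * (\<Sum>i<k. ennreal ((c i)\<^sup>2 * m\<^sup>2) * ?h i)"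
        by (rule sum_distrib_left[symmetric])
      finally have num: "?num \<le> ennreal (C / R) * (\<Sum>i<k. ennreal ((c i)\<^sup>2 * m\<^sup>2) * ?h i)" .
      have "(\<Sum>i<k. ennreal ((c i)\<^sup>2 * m\<^sup>2) * ?h i) = (\<Sum>i<k. ennreal ((c i)\<^sup>2 * m\<^sup>2) * emeasure ?H (frontier \<Omega> \<inter> grid_core R (f i)))"
        using n by (simp add: emeasure_hausdorff_measure frontier_Int_core_borel)
      also have "\<dots> = (\<integral>\<^sup>+x. (\<Sum>i<k. ennreal ((c i)\<^sup>2 * m\<^sup>2) * indicator (frontier \<Omega> \<inter> grid_core R (f i)) x) \<partial>?H)"
      proof -
        have "frontier \<Omega> \<inter> grid_core R (f i) \<in> sets ?H" for i
          by (simp add: sets_hausdorff_measure frontier_Int_core_borel)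
        then show ?thesis
          by (subst nn_integral_sum) (simp_all add: nn_integral_cmult_indicator
              borel_measurable_times_ennreal borel_measurable_indicator)
      qed
      also have "\<dots> \<le> (\<integral>\<^sup>+x. ennreal ((\<Sum>i<k. c i * \<phi> i x)\<^sup>2) * indicator (frontier \<Omega>) x \<partial>?H)"
      proof (intro nn_integral_mono)
        fix x
        have "(\<Sum>i<k. (c i)\<^sup>2 * m\<^sup>2 * indicator (grid_core R (f i)) x) \<le> (\<Sum>i<k. (norm (c i * \<phi> i x))\<^sup>2)"
        proof (intro sum_mono)
          fix i
          show "(c i)\<^sup>2 * m\<^sup>2 * indicator (grid_core R (f i)) x \<le> (norm (c i * \<phi> i x))\<^sup>2"
          proof (cases "x \<in> grid_core R (f i)")
            case True
            then have "m\<^sup>2 \<le> (\<phi> i x)\<^sup>2" using core m by (intro power_mono) auto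
            then show ?thesis using True by (simp add: power_mult_distrib mult_left_mono)
          qed simp
        qed
        also have "\<dots> = (norm (\<Sum>i<k. c i * \<phi> i x))\<^sup>2"
          using disj by (intro norm_sum_power2_orthogonal[symmetric]) auto
        finally have "(\<Sum>i<k. (c i)\<^sup>2 * m\<^sup>2 * indicator (grid_core R (f i)) x) \<le> (\<Sum>i<k. c i * \<phi> i x)\<^sup>2" by simp
        then have "ennreal (\<Sum>i<k. (c i)\<^sup>2 * m\<^sup>2 * indicator (grid_core R (f i)) x) \<le> ennreal ((\<Sum>i<k. c i * \<phi> i x)\<^sup>2)"
          by (rule ennreal_leI)
        then have le: "ennreal (\<Sum>i<k. (c i)\<^sup>2 * m\<^sup>2 * indicator (grid_core R (f i)) x) * indicator (frontier \<Omega>) x \<le>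
           ennreal ((\<Sum>i<k. c i * \<phi> i x)\<^sup>2) * indicator (frontier \<Omega>) x"
          by (rule mult_right_mono) simp
        have eq: "ennreal (\<Sum>i<k. (c i)\<^sup>2 * m\<^sup>2 * indicator (grid_core R (f i)) x) =
           (\<Sum>i<k. ennreal ((c i)\<^sup>2 * m\<^sup>2) * indicator (grid_core R (f i)) x)"
          by (subst sum_ennreal[symmetric]) (auto simp: indicator_def intro!: sum.cong)
        have "(\<Sum>i<k. ennreal ((c i)\<^sup>2 * m\<^sup>2) * indicator (frontier \<Omega> \<inter> grid_core R (f i)) x) =
           (\<Sum>i<k. ennreal ((c i)\<^sup>2 * m\<^sup>2) * indicator (grid_core R (f i)) x) * indicator (frontier \<Omega>) x"
          unfolding sum_distrib_right by (intro sum.cong) (auto simp: indicator_def)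
        also have "\<dots> \<le> ennreal ((\<Sum>i<k. c i * \<phi> i x)\<^sup>2) * indicator (frontier \<Omega>) x"
          using le unfolding eq .
        finally show "(\<Sum>i<k. ennreal ((c i)\<^sup>2 * m\<^sup>2) * indicator (frontier \<Omega> \<inter> grid_core R (f i)) x) \<le>
           ennreal ((\<Sum>i<k. c i * \<phi> i x)\<^sup>2) * indicator (frontier \<Omega>) x" .
      qed
      also have "\<dots> = ?den" by (rule nn_integral_surface_measure[OF n, symmetric])
      finally have den: "(\<Sum>i<k. ennreal ((c i)\<^sup>2 * m\<^sup>2) * ?h i) \<le> ?den" .
      obtain i where i: "i < k" "c i \<noteq> 0" using c by blast
      have "0 < ennreal ((c i)\<^sup>2 * m\<^sup>2) * ?h i"
        using i m pos[OF i(1)] by (simp add: ennreal_zero_less_mult_iff)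
      also have "\<dots> \<le> (\<Sum>i<k. ennreal ((c i)\<^sup>2 * m\<^sup>2) * ?h i)"
        using i by (intro member_le_sum) auto
      also note den
      finally have den_pos: "0 < ?den" .
      have "?num \<le> ennreal (C / R) * ?den"
        by (rule order_trans[OF num mult_left_mono[OF den]]) simp
      then have "?num / ?den \<le> ennreal (C / R)"
        using den_pos by (intro divide_le_posI_ennreal) (simp_all add: mult.commute)
      moreover have "?den \<noteq> 0"
        using den_pos by (rule dual_order.strict_implies_not_eq)
      ultimately show ?thesis
        by (simp add: steklov_quotient_def)
    qed
    show "steklov_eigenvalue \<Omega> k \<le> ennreal (C / R)"
      unfolding steklov_eigenvalue_def
    proof (rule Inf_lower2)
      show "(SUP c\<in>{c :: nat \<Rightarrow> real. \<exists>i<k. c i \<noteq> 0}.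
             steklov_quotient \<Omega> (\<lambda>x. \<Sum>i<k. c i *\<^sub>R gradient (\<phi> i) x) (\<lambda>x. \<Sum>i<k. c i * \<phi> i x)) \<le> ennreal (C / R)"
        using quot by (intro SUP_least) simp
    qed (intro CollectI exI[of _ \<phi>] exI[of _ "\<lambda>i. gradient (\<phi> i)"] conjI refl allI impI H1 indep)
  qed
qed

section \<open>Choice of the side length and conclusion\<close>

theorem theorem1p2:
  assumes "CARD('n::finite) \<ge> 2"
  shows "\<exists>C::real. C > 0 \<and>
    (\<forall>(\<Omega> :: (real^'n) set) (k::nat). smooth_bounded_domain \<Omega> \<longrightarrow> k \<ge> 1 \<longrightarrow>
       ennreal (measure lebesgue \<Omega> powr (1 / real CARD('n))) * steklov_eigenvalue \<Omega> k
         \<le> ennreal (C * real k powr (1 / (real CARD('n) - 1))))"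
proof -
  let ?n = "CARD('n)"
  obtain K where K: "K > 0" and many: "\<forall>(\<Omega>::(real^'n) set) R (N::nat). open \<Omega> \<longrightarrow> bounded \<Omega> \<longrightarrow> R > 0 \<longrightarrow> N \<ge> 1 \<longrightarrow>
    4 * R ^ ?n * (8 * real ?n * real N) powr (real ?n / (real ?n - 1)) \<le> measure lborel \<Omega> \<longrightarrow>
    (\<exists>A. finite A \<and> N \<le> card A \<and> (\<forall>p\<in>A. active_cube \<Omega> K R p))"
    using exists_many_active_cubes[OF assms] by (elim exE conjE) (rule that)
  obtain C where C: "C > 0" and eig: "\<forall>(\<Omega>::(real^'n) set) R B (k::nat). open \<Omega> \<longrightarrow> bounded \<Omega> \<longrightarrow> R > 0 \<longrightarrow> finite B \<longrightarrow> card B = k \<longrightarrow>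
    (\<forall>p\<in>B. active_cube \<Omega> K R p) \<longrightarrow>
    (\<forall>p\<in>B. \<forall>q\<in>B. p \<noteq> q \<longrightarrow> (\<exists>i. \<bar>p $ i - q $ i\<bar> \<ge> 5)) \<longrightarrow>
    steklov_eigenvalue \<Omega> k \<le> ennreal (C / R)"
    using steklov_eigenvalue_le[OF assms K] by (elim exE conjE) (rule that)
  \<comment> \<open>8 * n comes from counting active cubes, and 5 ^ n from selecting
    \<open>k\<close> of them with disjoint blocks.\<close>
  define s where "s = 8 * real ?n * 5 ^ ?n"
  have s: "s > 0" by (simp add: s_def)
  \<comment> \<open>The volume cancels in V powr (1 / n) * (C / R) = C * (4 * M) powr (1 / n), and M
    powr (1 / n) equals (s * k) powr (1 / (n - 1)).\<close>
  define c where "c = C * 4 powr (1 / ?n) * s powr (1 / (real ?n - 1))"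
  have c: "c > 0" using C s by (simp add: c_def)
  show ?thesis
  proof (intro exI[of _ c] conjI c allI impI)
    fix \<Omega> :: "(real^'n) set" and k :: nat
    assume \<Omega>: "smooth_bounded_domain \<Omega>" and k: "k \<ge> 1"
    have o: "open \<Omega>" "bounded \<Omega>" "\<Omega> \<noteq> {}" using \<Omega> by (auto simp: smooth_bounded_domain_def)
    define V where "V = measure lborel \<Omega>"
    have V: "V > 0"
    proof -
      have "emeasure lborel \<Omega> < top" using emeasure_bounded_finite[OF o(2)] by simp
      moreover have "emeasure lborel \<Omega> \<noteq> 0"
      proof
        assume "emeasure lborel \<Omega> = 0"
        then have "\<Omega> \<in> null_sets lborel" using o(1) by (auto simp: null_sets_def)
        then have "negligible \<Omega>" by (simp add: negligible_iff_null_sets null_sets_completionI)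
        then show False using open_not_negligible o by blast
      qed
      ultimately show ?thesis
        by (simp add: V_def measure_def enn2real_positive_iff zero_less_iff_neq_zero)
    qed
    define M where "M = (s * k) powr (real ?n / (real ?n - 1))"
    have M: "M > 0" using s k by (simp add: M_def)
    \<comment> \<open>The largest side length allowed by the counting lemma: 4 * R ^ n * M =
      V.\<close>
    define R where "R = (V / (4 * M)) powr (1 / ?n)"
    have R: "R > 0" using V M by (simp add: R_def)
    have "R ^ ?n = V / (4 * M)"
      using V M R by (simp add: R_def powr_realpow[symmetric] powr_powr)
    then have "4 * R ^ ?n * M \<le> V" using M by simp
    moreover have "8 * real ?n * real (5 ^ ?n * k) = s * k" by (simp add: s_def)
    ultimately have "4 * R ^ ?n * (8 * real ?n * real (5 ^ ?n * k)) powr (real ?n / (real ?n - 1)) \<le> measure lborel \<Omega>"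
      by (simp only: M_def V_def)
    moreover have "5 ^ ?n * k \<ge> 1" using k by simp
    ultimately obtain A where A: "finite A" "5 ^ ?n * k \<le> card A" "\<forall>p\<in>A. active_cube \<Omega> K R p"
      using many[rule_format, OF o(1,2) R] by blast
    then obtain B where B: "B \<subseteq> A" "card B = k" "\<forall>p\<in>B. \<forall>q\<in>B. p \<noteq> q \<longrightarrow> (\<exists>i. \<bar>p $ i - q $ i\<bar> \<ge> 5)"
      using exists_separated_subset[OF A(1,2) k] by blast
    have "finite B" using A(1) B(1) by (rule rev_finite_subset)
    then have "steklov_eigenvalue \<Omega> k \<le> ennreal (C / R)"
      using eig[rule_format, OF o(1,2) R, of B k] A(3) B by blast
    then have "ennreal (V powr (1 / ?n)) * steklov_eigenvalue \<Omega> k \<le> ennreal (V powr (1 / ?n)) * ennreal (C / R)"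
      by (rule mult_left_mono) simp
    also have "\<dots> = ennreal (V powr (1 / ?n) * (C / R))"
      by (rule ennreal_mult'[symmetric]) simp
    also have "V powr (1 / ?n) * (C / R) = C * (4 * M) powr (1 / ?n)"
      using V M by (simp add: R_def powr_divide)
    also have "\<dots> = c * real k powr (1 / (real ?n - 1))"
    proof -
      have "M powr (1 / ?n) = (s * k) powr (1 / (real ?n - 1))"
        by (simp add: M_def powr_powr)
      then show ?thesis using M s by (simp add: c_def powr_mult)
    qed
    finally show "ennreal (measure lebesgue \<Omega> powr (1 / real ?n)) * steklov_eigenvalue \<Omega> k
         \<le> ennreal (c * real k powr (1 / (real ?n - 1)))"
      using o(1) by (simp add: V_def)
  qed
qed

end
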